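(* Let $l\geq 1$ be an integer. Assume that $T_1, T_2, \ldots, T_l$ are commuting invertible ergodic measure preserving transformations of a probability space $(X, \mathcal{X}, \mu)$ such that $T_iT_j^{-1}$ is ergodic for all $i,j\in \{1, 2, \ldots, l\}$ with $i\neq j$. Then for all $f_1, f_2, \ldots, f_l\in L^\infty(\mu)$ the averages $$ \frac{1}{N}\sum_{n=0}^{N-1}f_1(T_1^nx)\cdot f_2(T_2^nx)\cdot\ldots \cdot f_l(T_l^nx) $$ converge in $L^2(\mu)$ as $N\to +\infty$.
   Context: Functions are real valued. "Commuting" means $T_iT_j=T_jT_i$ for all $i,j$. A measure preserving transformation is ergodic if every invariant measurable set has measure $0$ or $1$. *)

theory Defs
  imports "HOL-Probability.Probability"
begin

text \<open>
  Transformations are honest functions on the carrier \<^term>\<open>space M\<close>; their values outside the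
  carrier play no role.
\<close>

definition measure_preserving :: "'a measure \<Rightarrow> ('a \<Rightarrow> 'a) \<Rightarrow> bool" where
  "measure_preserving M T \<longleftrightarrow>
     T \<in> M \<rightarrow>\<^sub>M M \<and> (\<forall>A\<in>sets M. emeasure M (T -` A \<inter> space M) = emeasure M A)"

definition invertible_measure_preserving :: "'a measure \<Rightarrow> ('a \<Rightarrow> 'a) \<Rightarrow> bool" where
  "invertible_measure_preserving M T \<longleftrightarrow>
     measure_preserving M T \<and> bij_betw T (space M) (space M) \<and>
     inv_into (space M) T \<in> M \<rightarrow>\<^sub>M M"

definition ergodic :: "'a measure \<Rightarrow> ('a \<Rightarrow> 'a) \<Rightarrow> bool" where
  "ergodic M T \<longleftrightarrow>
     measure_preserving M T \<and>
     (\<forall>A\<in>sets M. T -` A \<inter> space M = A \<longrightarrow> measure M A = 0 \<or> measure M A = 1)"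

text \<open>Elements of the Lebesgue spaces are represented by functions, not by classes modulo
  almost everywhere equality.\<close>

definition Linfty :: "'a measure \<Rightarrow> ('a \<Rightarrow> real) set" where
  "Linfty M = {f \<in> borel_measurable M. esssup M (\<lambda>x. ereal \<bar>f x\<bar>) < \<infinity>}"

definition L2 :: "'a measure \<Rightarrow> ('a \<Rightarrow> real) set" where
  "L2 M = {f \<in> borel_measurable M. integrable M (\<lambda>x. (f x)\<^sup>2)}"

definition L2_norm :: "'a measure \<Rightarrow> ('a \<Rightarrow> real) \<Rightarrow> real" where
  "L2_norm M f = sqrt (\<integral>x. (f x)\<^sup>2 \<partial>M)"

text \<open>The membership requirements ensure that the Bochner integral in \<^term>\<open>L2_norm\<close> is not
  the default value \<open>0\<close> of a non-integrable function.\<close>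

definition converges_in_L2 :: "'a measure \<Rightarrow> (nat \<Rightarrow> 'a \<Rightarrow> real) \<Rightarrow> bool" where
  "converges_in_L2 M F \<longleftrightarrow>
     (\<forall>N. F N \<in> L2 M) \<and>
     (\<exists>g\<in>L2 M. (\<lambda>N. L2_norm M (\<lambda>x. F N x - g x)) \<longlonglongrightarrow> 0)"

end

theory Submission
  imports Defs
begin

text \<open>
  The proof follows Walsh's argument and is by induction on the number \<open>j\<close> of transformations.
  What is proved by induction is a quantitative form of Cauchy convergence
  in \<open>L\<^sup>1\<close> (metastability), uniform over all families of functions indexed by a finite probability
  space. If the average of \<open>f\<^sub>1, \<dots>, f\<^sub>j, r\<close> is not small in \<open>L\<^sup>1\<close>, then \<open>r\<close> correlates with a
  function \<open>\<sigma>\<close> such that \<open>\<sigma> (T\<^sub>j\<^sub>+\<^sub>1\<^sup>n x)\<close> is, for all small \<open>n\<close>, nearly a mean over a parameter \<open>m\<close>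
  of products \<open>b\<^sub>0 (x) b\<^sub>1 (T\<^sub>1\<^sup>n x) \<dots> b\<^sub>j (T\<^sub>j\<^sup>n x)\<close>. An energy decrement argument writes \<open>f\<^sub>j\<^sub>+\<^sub>1\<close> as
  a bounded combination of such functions plus a remainder not correlating with any of them. The
  remainder contributes little, and for the combination the average over \<open>j + 1\<close> transformations
  becomes a mean over \<open>m\<close> of averages over \<open>j\<close> transformations.
\<close>

section \<open>Reducible functions\<close>

text \<open>The bound is required at every point of the type instead of almost everywhere, so that
  estimates of averages can be made pointwise, with no null sets to track.\<close>

definition unit_ball :: "'a measure \<Rightarrow> ('a \<Rightarrow> real) set" where
  "unit_ball M = {f \<in> borel_measurable M. \<forall>x. \<bar>f x\<bar> \<le> 1}"

lemma unit_ballD: "f \<in> unit_ball M \<Longrightarrow> f \<in> borel_measurable M" "f \<in> unit_ball M \<Longrightarrow> \<bar>f x\<bar> \<le> 1"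
  by (auto simp: unit_ball_def)

lemma abs_mult_le_1: "\<bar>a\<bar> \<le> 1 \<Longrightarrow> \<bar>b\<bar> \<le> 1 \<Longrightarrow> \<bar>a * b\<bar> \<le> (1::real)"
  by (simp add: abs_mult mult_le_one)

lemma abs_prod_le_1: "(\<And>i. i \<in> I \<Longrightarrow> \<bar>f i\<bar> \<le> (1::real)) \<Longrightarrow> \<bar>\<Prod>i\<in>I. f i\<bar> \<le> 1"
  by (simp add: abs_prod prod_le_1)

lemma abs_average_le_1:
  assumes "\<And>n. n < N \<Longrightarrow> \<bar>f n\<bar> \<le> (1::real)"
  shows "\<bar>(\<Sum>n<N. f n) / real N\<bar> \<le> 1"
proof -
  have "\<bar>\<Sum>n<N. f n\<bar> \<le> (\<Sum>n<N. 1)"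
    by (rule sum_abs[THEN order_trans], rule sum_mono) (use assms in auto)
  then show ?thesis by (cases "N = 0") (auto simp: divide_le_eq_1)
qed

lemma unit_ball_mult: "f \<in> unit_ball M \<Longrightarrow> g \<in> unit_ball M \<Longrightarrow> (\<lambda>x. f x * g x) \<in> unit_ball M"
  by (auto simp: unit_ball_def abs_mult_le_1)

lemma unit_ball_prod:
  "(\<And>i. i \<in> I \<Longrightarrow> f i \<in> unit_ball M) \<Longrightarrow> (\<lambda>x. \<Prod>i\<in>I. f i x) \<in> unit_ball M"
  by (auto simp: unit_ball_def intro!: abs_prod_le_1 borel_measurable_prod)

lemma unit_ball_compose: "f \<in> unit_ball M \<Longrightarrow> g \<in> M \<rightarrow>\<^sub>M M \<Longrightarrow> (\<lambda>x. f (g x)) \<in> unit_ball M"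
  by (auto simp: unit_ball_def)

lemma unit_ball_average:
  "(\<And>n. n < N \<Longrightarrow> f n \<in> unit_ball M) \<Longrightarrow> (\<lambda>x. (\<Sum>n<N. f n x) / real N) \<in> unit_ball M"
  unfolding unit_ball_def mem_Collect_eq
  by (intro conjI allI abs_average_le_1 borel_measurable_divide borel_measurable_sum) auto

lemma (in finite_measure) integrable_bounded:
  "f \<in> borel_measurable M \<Longrightarrow> (\<And>x. \<bar>f x\<bar> \<le> B) \<Longrightarrow> integrable M (f :: 'a \<Rightarrow> real)"
  by (rule integrable_const_bound[where B=B]) auto

lemma (in prob_space) integral_le_bound:
  "f \<in> borel_measurable M \<Longrightarrow> (\<And>x. \<bar>f x\<bar> \<le> B) \<Longrightarrow> (\<integral>x. f x \<partial>M) \<le> (B :: real)"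
  by (intro integral_le_const integrable_bounded AE_I2) (auto simp: abs_le_iff)

section \<open>Multiple averages and functions that reduce to fewer transformations\<close>

definition multi_avg ::
  "(nat \<Rightarrow> 'a \<Rightarrow> 'a) \<Rightarrow> nat \<Rightarrow> (nat \<Rightarrow> 'a \<Rightarrow> real) \<Rightarrow> nat \<Rightarrow> 'a \<Rightarrow> real" where
  "multi_avg T j f N x = (\<Sum>n<N. \<Prod>i=1..j. f i ((T i ^^ n) x)) / real N"

text \<open>At times up to \<open>L\<close>, the values of \<sigma> along an orbit of
  \<open>T (Suc j)\<close> are governed by the first \<open>j\<close> transformations alone; the
  unshifted factor \<open>b 0 m\<close> absorbs the rest. A finite mean is encoded as a probability
  on the natural numbers, so that nested means can be coded in the same type by
  \<open>mixture\<close>.\<close>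

definition reducible ::
  "'a measure \<Rightarrow> (nat \<Rightarrow> 'a \<Rightarrow> 'a) \<Rightarrow> nat \<Rightarrow> nat \<Rightarrow> real \<Rightarrow> ('a \<Rightarrow> real) \<Rightarrow> bool" where
  "reducible M T j L \<eta> \<sigma> \<longleftrightarrow> \<sigma> \<in> unit_ball M \<and>
     (\<exists>(q :: nat pmf) b. finite (set_pmf q) \<and> (\<forall>i m. b i m \<in> unit_ball M) \<and>
       (\<forall>l\<le>L. \<forall>x. \<bar>\<sigma> ((T (Suc j) ^^ l) x) -
          (\<integral>m. b 0 m x * (\<Prod>i=1..j. b i m ((T i ^^ l) x)) \<partial>q)\<bar> \<le> \<eta>))"

lemma reducible_mono:
  "reducible M T j L \<eta> \<sigma> \<Longrightarrow> L' \<le> L \<Longrightarrow> reducible M T j L' \<eta> \<sigma>"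
  unfolding reducible_def by (meson order_trans)

text \<open>The identities hold on the whole type and the inverses \<open>R\<close> are given as
  data, so iterates can be rewritten without carrier conditions. The theorem arranges this by the
  identity map outside the carrier.\<close>

locale commuting_system = prob_space M for M :: "'a measure" +
  fixes T R :: "nat \<Rightarrow> 'a \<Rightarrow> 'a"
  assumes T_measurable [measurable]: "T i \<in> M \<rightarrow>\<^sub>M M"
    and R_measurable [measurable]: "R i \<in> M \<rightarrow>\<^sub>M M"
    and distr_T: "distr M M (T i) = M"
    and R_T: "R i (T i x) = x"
    and T_R: "T i (R i x) = x"
    and T_commute: "T i (T k x) = T k (T i x)"
begin

section \<open>Powers of the transformations and of their inverses\<close>

lemma T_pow_measurable [measurable]: "T i ^^ n \<in> M \<rightarrow>\<^sub>M M"
  by (induction n) auto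

lemma R_pow_measurable [measurable]: "R i ^^ n \<in> M \<rightarrow>\<^sub>M M"
  by (induction n) auto

lemma integral_T_pow:
  fixes f :: "'a \<Rightarrow> real"
  assumes [measurable]: "f \<in> borel_measurable M"
  shows "(\<integral>x. f ((T i ^^ n) x) \<partial>M) = (\<integral>x. f x \<partial>M)"
proof (induction n)
  case (Suc n)
  have "(\<integral>x. f ((T i ^^ n) x) \<partial>distr M M (T i)) = (\<integral>x. f ((T i ^^ n) (T i x)) \<partial>M)"
    by (intro integral_distr) auto
  then show ?case using Suc by (simp add: distr_T funpow_swap1)
qed simp

lemma R_pow_T_pow: "(R i ^^ n) ((T i ^^ n) x) = x"
proof (induction n arbitrary: x)
  case (Suc n)
  have "(R i ^^ Suc n) ((T i ^^ Suc n) x) = R i ((R i ^^ n) ((T i ^^ n) (T i x)))"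
    by (simp add: funpow_swap1)
  then show ?case by (simp add: Suc R_T)
qed simp

lemma T_R_commute: "T i (R k x) = R k (T i x)"
  by (metis R_T T_R T_commute)

lemma T_pow_R_pow_commute: "(T i ^^ n) ((R k ^^ m) x) = (R k ^^ m) ((T i ^^ n) x)"
proof -
  have *: "(T i ^^ n) (R k x) = R k ((T i ^^ n) x)" for x
    by (induction n) (auto simp: T_R_commute)
  show ?thesis by (induction m) (auto simp: *)
qed

text \<open>The substitution \<open>n = m + l\<close> turns the shift by \<open>T\<^sub>j\<^sub>+\<^sub>1\<^sup>l\<close> of an average over
  \<open>n < N\<close> into shifts by \<open>T\<^sub>i\<^sup>l\<close>, \<open>i \<le> j\<close>, up to \<open>2l\<close> boundary terms.\<close>

lemma reducible_dual:
  assumes g: "g \<in> unit_ball M" and f: "\<And>i. f i \<in> unit_ball M"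
    and N: "0 < N" "L \<le> N" "2 * real L \<le> \<eta> * real N"
  shows "reducible M T j L \<eta>
    (\<lambda>x. (\<Sum>n<N. g ((R (Suc j) ^^ n) x) * (\<Prod>i=1..j. f i ((T i ^^ n) ((R (Suc j) ^^ n) x)))) / real N)"
    (is "reducible M T j L \<eta> ?h")
proof -
  let ?R = "R (Suc j)"
  define \<psi> where "\<psi> n y = g ((?R ^^ n) y) * (\<Prod>i=1..j. f i ((T i ^^ n) ((?R ^^ n) y)))" for n y
  \<comment> \<open>\<open>T (Suc j) ^^ l\<close> cancels \<open>l\<close> of the
    \<open>m + l\<close> inverse steps. Hence \<open>g\<close> is left unshifted and becomes the
    factor of index 0, while every other factor keeps exactly the shift
    \<open>T i ^^ l\<close>.\<close>
  define b where "b i m = (if i = 0 then (\<lambda>x. g ((?R ^^ m) x)) else (\<lambda>x. f i ((T i ^^ m) ((?R ^^ m) x))))"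
    for i m :: nat
  have \<psi>: "\<psi> n \<in> unit_ball M" for n
    unfolding \<psi>_def by (intro unit_ball_mult unit_ball_prod unit_ball_compose[OF g] unit_ball_compose[OF f]) measurable
  have b: "b i m \<in> unit_ball M" for i m
    using unit_ball_compose[OF g, of "?R ^^ m"] unit_ball_compose[OF f, of "\<lambda>x. (T i ^^ m) ((?R ^^ m) x)" i]
    by (auto simp: b_def)
  define q where "q = pmf_of_set {..<N}"
  have q: "finite (set_pmf q)" using N by (simp add: q_def set_pmf_of_set lessThan_empty_iff)
  have "\<bar>?h ((T (Suc j) ^^ l) x) - (\<integral>m. b 0 m x * (\<Prod>i=1..j. b i m ((T i ^^ l) x)) \<partial>q)\<bar> \<le> \<eta>"
    if l: "l \<le> L" for l x
  proof -
    let ?y = "(T (Suc j) ^^ l) x"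
    define \<phi> where "\<phi> m = b 0 m x * (\<Prod>i=1..j. b i m ((T i ^^ l) x))" for m
    have \<phi>1: "\<bar>\<phi> m\<bar> \<le> 1" for m
      unfolding \<phi>_def by (intro abs_mult_le_1 abs_prod_le_1 unit_ballD(2)[OF b])
    have \<psi>1: "\<bar>\<psi> m ?y\<bar> \<le> 1" for m by (rule unit_ballD(2)[OF \<psi>])
    have shift: "\<psi> (m + l) ?y = \<phi> m" for m
    proof -
      have R: "(?R ^^ (m + l)) ?y = (?R ^^ m) x"
        by (simp add: funpow_add R_pow_T_pow)
      have "(T i ^^ (m + l)) ((?R ^^ m) x) = (T i ^^ m) ((?R ^^ m) ((T i ^^ l) x))" for i
        by (simp add: funpow_add T_pow_R_pow_commute)
      then show ?thesis unfolding \<psi>_def \<phi>_def R b_def by (auto intro!: prod.cong)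
    qed
    have lN: "l \<le> N" using l N by simp
    have "(\<Sum>n<N. \<psi> n ?y) = (\<Sum>n<l. \<psi> n ?y) + (\<Sum>m<N - l. \<psi> (m + l) ?y)"
      using lN
        sum.atLeastLessThan_concat[of 0 l N "\<lambda>n. \<psi> n ?y"]
        sum.shift_bounds_nat_ivl[of "\<lambda>n. \<psi> n ?y" 0 l "N - l"]
      by (simp add: atLeast0LessThan)
    moreover have "(\<Sum>m<N. \<phi> m) = (\<Sum>m<N - l. \<phi> m) + (\<Sum>m=N-l..<N. \<phi> m)"
      using sum.atLeastLessThan_concat[of 0 "N - l" N \<phi>] by (simp add: atLeast0LessThan)
    moreover have "\<bar>\<Sum>n<l. \<psi> n ?y\<bar> \<le> (\<Sum>n<l. 1)"
      by (rule sum_abs[THEN order_trans], rule sum_mono) (rule \<psi>1)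
    moreover have "\<bar>\<Sum>m=N-l..<N. \<phi> m\<bar> \<le> (\<Sum>m=N-l..<N. 1)"
      by (rule sum_abs[THEN order_trans], rule sum_mono) (rule \<phi>1)
    ultimately have "\<bar>(\<Sum>n<N. \<psi> n ?y) - (\<Sum>m<N. \<phi> m)\<bar> \<le> 2 * real l"
      using lN by (simp add: shift)
    also have "\<dots> \<le> \<eta> * real N" using l N by linarith
    finally have "\<bar>((\<Sum>n<N. \<psi> n ?y) - (\<Sum>m<N. \<phi> m)) / real N\<bar> \<le> \<eta>"
      using N by (simp add: divide_le_eq)
    moreover have "(\<integral>m. \<phi> m \<partial>q) = (\<Sum>m<N. \<phi> m) / real N"
      using N by (simp add: q_def integral_pmf_of_set lessThan_empty_iff)
    ultimately show ?thesis by (simp add: \<psi>_def \<phi>_def diff_divide_distrib)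
  qed
  moreover have "?h \<in> unit_ball M"
    using unit_ball_average[of N \<psi> M] \<psi> by (simp add: \<psi>_def)
  ultimately show ?thesis using q b unfolding reducible_def by blast
qed

lemma measurable_multi_avg [measurable]:
  assumes [measurable]: "\<And>i. f i \<in> borel_measurable M"
  shows "multi_avg T j f N \<in> borel_measurable M"
  unfolding multi_avg_def[abs_def] by measurable

lemma multi_avg_unit_ball:
  assumes f: "\<And>i. f i \<in> unit_ball M"
  shows "multi_avg T j f N \<in> unit_ball M"
  unfolding multi_avg_def[abs_def]
  by (intro unit_ball_average unit_ball_prod unit_ball_compose[OF f]) measurable

text \<open>Testing the average against its own sign and moving \<open>T\<^sub>j\<^sub>+\<^sub>1\<^sup>n\<close> to the other factors
  pairs \<open>r\<close> with a reducible function.\<close>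

lemma multi_avg_random_le:
  assumes f: "\<And>i. f i \<in> unit_ball M"
    and r [measurable]: "r \<in> borel_measurable M" and rB: "\<And>x. \<bar>r x\<bar> \<le> B"
    and orth: "\<And>\<sigma>. reducible M T j L \<eta> \<sigma> \<Longrightarrow> \<bar>\<integral>x. r x * \<sigma> x \<partial>M\<bar> \<le> \<delta>"
    and N: "0 < N" "L \<le> N" "2 * real L \<le> \<eta> * real N"
  shows "(\<integral>x. \<bar>multi_avg T (Suc j) (f(Suc j := r)) N x\<bar> \<partial>M) \<le> \<delta>"
proof -
  let ?R = "R (Suc j)" and ?T = "T (Suc j)"
  define A where "A = multi_avg T (Suc j) (f(Suc j := r)) N"
  have [measurable]: "f i \<in> borel_measurable M" for i using f unit_ballD by blast
  have fr [measurable]: "(f(Suc j := r)) i \<in> borel_measurable M" for i by (cases "i = Suc j") auto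
  have Am [measurable]: "A \<in> borel_measurable M" unfolding A_def by measurable
  define g where "g x = sgn (A x)" for x
  have g: "g \<in> unit_ball M" unfolding unit_ball_def g_def[abs_def] by (auto simp: sgn_if)
  then have gm [measurable]: "g \<in> borel_measurable M" by (rule unit_ballD)
  define G where "G n x = g x * (\<Prod>i=1..j. f i ((T i ^^ n) x))" for n x
  have G: "G n \<in> unit_ball M" for n
    unfolding G_def[abs_def] by (intro unit_ball_mult g unit_ball_prod unit_ball_compose[OF f]) measurable
  have Gm [measurable]: "G n \<in> borel_measurable M" for n using G by (rule unit_ballD)
  define h where "h x = (\<Sum>n<N. G n ((?R ^^ n) x)) / real N" for x
  have red: "reducible M T j L \<eta> h"
    using reducible_dual[OF g f N, of j] unfolding h_def[abs_def] G_def .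
  have B0: "0 \<le> B" using rB[of undefined] by simp
  have bnd: "\<bar>G n x * r y\<bar> \<le> B" for n x y
    using mult_mono[OF unit_ballD(2)[OF G, of n x] rB[of y]] by (simp add: abs_mult)
  have i1: "integrable M (\<lambda>x. G n x * r ((?T ^^ n) x))" for n
    by (rule integrable_bounded[where B=B]) (auto intro: bnd)
  have i2: "integrable M (\<lambda>x. G n ((?R ^^ n) x) * r x)" for n
    by (rule integrable_bounded[where B=B]) (auto intro: bnd)
  have "\<bar>A x\<bar> = (\<Sum>n<N. G n x * r ((?T ^^ n) x)) / real N" for x
  proof -
    have "\<bar>A x\<bar> = g x * A x" by (simp add: g_def sgn_if)
    moreover have "A x = (\<Sum>n<N. (\<Prod>i=1..j. f i ((T i ^^ n) x)) * r ((?T ^^ n) x)) / real N"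
      unfolding A_def multi_avg_def by (auto intro!: sum.cong prod.cong arg_cong2[where f="(/)"])
    moreover have "g x * ((\<Sum>n<N. (\<Prod>i=1..j. f i ((T i ^^ n) x)) * r ((?T ^^ n) x)) / real N) = (\<Sum>n<N. G n x * r ((?T ^^ n) x)) / real N"
      by (simp add: G_def sum_distrib_left mult.assoc)
    ultimately show ?thesis by metis
  qed
  then have "(\<integral>x. \<bar>A x\<bar> \<partial>M) = (\<Sum>n<N. \<integral>x. G n x * r ((?T ^^ n) x) \<partial>M) / real N"
    using i1 by simp
  \<comment> \<open>Invariance under \<open>T (Suc j) ^^ n\<close> is applied to the integrand on
    the right, in which \<open>R (Suc j) ^^ n\<close> then cancels.\<close>
  also have "\<dots> = (\<Sum>n<N. \<integral>x. G n ((?R ^^ n) x) * r x \<partial>M) / real N"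
  proof -
    have "(\<integral>x. G n x * r ((?T ^^ n) x) \<partial>M) = (\<integral>x. G n ((?R ^^ n) x) * r x \<partial>M)" for n
      using integral_T_pow[of "\<lambda>x. G n ((?R ^^ n) x) * r x" n "Suc j"] by (simp add: R_pow_T_pow)
    then show ?thesis by simp
  qed
  also have "\<dots> = (\<integral>x. r x * h x \<partial>M)"
    unfolding h_def using i2 by (simp add: sum_distrib_left mult.commute)
  also have "\<dots> \<le> \<delta>" using orth[OF red] by simp
  finally show ?thesis unfolding A_def .
qed

end

section \<open>Decomposition into a structured and a random part\<close>

text \<open>The number \<open>k\<close> of terms is recorded because it bounds the function and
  multiplies the error \<eta> when each term is replaced by its mean.\<close>

definition structured ::
  "'a measure \<Rightarrow> (nat \<Rightarrow> 'a \<Rightarrow> 'a) \<Rightarrow> nat \<Rightarrow> nat \<Rightarrow> real \<Rightarrow> nat \<Rightarrow> ('a \<Rightarrow> real) \<Rightarrow> bool" where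
  "structured M T j L \<eta> k s \<longleftrightarrow>
     (\<exists>(c :: nat \<Rightarrow> real) \<sigma>. s = (\<lambda>x. \<Sum>t<k. c t * \<sigma> t x) \<and>
        (\<forall>t<k. \<bar>c t\<bar> \<le> 1 \<and> reducible M T j L \<eta> (\<sigma> t)))"

lemma structured_0: "structured M T j L \<eta> 0 (\<lambda>x. 0)"
  by (simp add: structured_def)

lemma structured_mono:
  "structured M T j L \<eta> k s \<Longrightarrow> L' \<le> L \<Longrightarrow> structured M T j L' \<eta> k s"
  unfolding structured_def by (blast intro: reducible_mono)

lemma structured_Suc:
  assumes "structured M T j L \<eta> k s" "reducible M T j L \<eta> \<tau>" "\<bar>a\<bar> \<le> 1"
  shows "structured M T j L \<eta> (Suc k) (\<lambda>x. s x + a * \<tau> x)"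
proof -
  obtain c \<sigma> where "s = (\<lambda>x. \<Sum>t<k. c t * \<sigma> t x)"
    "\<forall>t<k. \<bar>c t\<bar> \<le> 1 \<and> reducible M T j L \<eta> (\<sigma> t)"
    using assms(1) unfolding structured_def by blast
  then show ?thesis using assms(2,3) unfolding structured_def
    by (intro exI[of _ "c(k := a)"] exI[of _ "\<sigma>(k := \<tau>)"]) (auto simp: less_Suc_eq)
qed

lemma structured_measurable: "structured M T j L \<eta> k s \<Longrightarrow> s \<in> borel_measurable M"
  by (auto simp: structured_def reducible_def unit_ball_def intro!: borel_measurable_sum borel_measurable_times)

lemma structured_bound:
  assumes "structured M T j L \<eta> k s" shows "\<bar>s x\<bar> \<le> real k"
proof -
  obtain c \<sigma> where s: "s = (\<lambda>x. \<Sum>t<k. c t * \<sigma> t x)"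
    and c: "\<forall>t<k. \<bar>c t\<bar> \<le> 1 \<and> reducible M T j L \<eta> (\<sigma> t)"
    using assms unfolding structured_def by blast
  have "\<bar>s x\<bar> \<le> (\<Sum>t<k. 1)" unfolding s
    by (rule sum_abs[THEN order_trans], rule sum_mono)
       (use c in \<open>auto intro!: abs_mult_le_1 simp: reducible_def unit_ball_def\<close>)
  then show ?thesis by simp
qed

section \<open>Energy decrement and its iteration\<close>

context prob_space
begin

text \<open>Let \<open>a\<close> be the inner product of \<open>r\<close> and \<sigma>. Subtracting
  \<open>a * \<sigma>\<close> changes the energy by \<open>- 2 * a\<^sup>2\<close> plus
  \<open>a\<^sup>2\<close> times the energy of \<sigma>, which is at most 1. The net loss is at
  least \<open>a\<^sup>2\<close>, hence at least \<open>\<delta>\<^sup>2\<close>.\<close>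

lemma energy_decrement:
  fixes r \<sigma> :: "'a \<Rightarrow> real"
  assumes r [measurable]: "r \<in> borel_measurable M" and rB: "\<And>x. \<bar>r x\<bar> \<le> B"
    and \<sigma>: "\<sigma> \<in> unit_ball M" and energy: "(\<integral>x. (r x)\<^sup>2 \<partial>M) \<le> E" "E \<le> 1"
    and corr: "\<not> \<bar>\<integral>x. r x * \<sigma> x \<partial>M\<bar> \<le> \<delta>" "0 < \<delta>"
  obtains a where "\<bar>a\<bar> \<le> 1" "(\<integral>x. (r x - a * \<sigma> x)\<^sup>2 \<partial>M) \<le> E - \<delta>\<^sup>2"
proof -
  define a where "a = (\<integral>x. r x * \<sigma> x \<partial>M)"
  have [measurable]: "\<sigma> \<in> borel_measurable M" and \<sigma>1: "\<bar>\<sigma> x\<bar> \<le> 1" for x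
    using unit_ballD[OF \<sigma>] by auto
  have \<sigma>2: "(\<sigma> x)\<^sup>2 \<le> 1" for x using \<sigma>1[of x] by (simp add: abs_square_le_1)
  have i1: "integrable M (\<lambda>x. (r x)\<^sup>2)"
    by (rule integrable_bounded[where B="B\<^sup>2"])
       (use rB in \<open>auto simp flip: abs_le_square_iff simp: order_trans[OF _ abs_ge_self]\<close>)
  have i2: "integrable M (\<lambda>x. (\<sigma> x)\<^sup>2)"
    by (rule integrable_bounded[where B=1]) (auto simp: \<sigma>2)
  have i3: "integrable M (\<lambda>x. r x * \<sigma> x)"
  proof (rule integrable_bounded[where B=B])
    show "\<bar>r x * \<sigma> x\<bar> \<le> B" for x
      using mult_mono[OF rB[of x] \<sigma>1[of x]] rB[of x] by (simp add: abs_mult)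
  qed auto
  have s: "(\<integral>x. (\<sigma> x)\<^sup>2 \<partial>M) \<le> 1"
    by (intro integral_le_const i2 AE_I2 \<sigma>2)
  \<comment> \<open>Both energies are at most 1, so the inequality of arithmetic and geometric means
    gives the bound that \<open>structured\<close> demands of coefficients.\<close>
  have "\<bar>a\<bar> \<le> (\<integral>x. \<bar>r x * \<sigma> x\<bar> \<partial>M)" unfolding a_def by (rule integral_abs_bound)
  also have "\<dots> \<le> (\<integral>x. ((r x)\<^sup>2 + (\<sigma> x)\<^sup>2) / 2 \<partial>M)"
  proof (rule integral_mono)
    show "\<bar>r x * \<sigma> x\<bar> \<le> ((r x)\<^sup>2 + (\<sigma> x)\<^sup>2) / 2" for x
      using sum_squares_bound[of "\<bar>r x\<bar>" "\<bar>\<sigma> x\<bar>"] by (simp add: abs_mult)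
  qed (use i1 i2 i3 in auto)
  also have "\<dots> \<le> 1" using i1 i2 s energy by simp
  finally have a1: "\<bar>a\<bar> \<le> 1" .
  have "(r x - a * \<sigma> x)\<^sup>2 = (r x)\<^sup>2 - 2 * a * (r x * \<sigma> x) + a\<^sup>2 * (\<sigma> x)\<^sup>2" for x
    by (simp add: power2_eq_square algebra_simps)
  then have "(\<integral>x. (r x - a * \<sigma> x)\<^sup>2 \<partial>M)
      = (\<integral>x. (r x)\<^sup>2 \<partial>M) - 2 * a * a + a\<^sup>2 * (\<integral>x. (\<sigma> x)\<^sup>2 \<partial>M)"
    using i1 i2 i3 by (simp add: a_def)
  also have "\<dots> \<le> E - 2 * a * a + a\<^sup>2 * 1"
    using energy mult_left_mono[OF s, of "a\<^sup>2"] by simp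
  also have "\<dots> = E - a\<^sup>2" by (simp add: power2_eq_square)
  also have "\<dots> \<le> E - \<delta>\<^sup>2"
    using corr abs_le_square_iff[of \<delta> a] by (simp add: a_def)
  finally show thesis using that a1 by blast
qed

text \<open>While the remainder correlates with some reducible function, a multiple of that function
  is moved to the structured part. The energy is at most 1 at first and loses
  \<open>\<delta>\<^sup>2\<close> each time, so fewer than \<open>C\<close> moves occur. The scales
  are run through downwards: a smaller \<open>L\<close> weakens reducibility, so earlier terms stay
  admissible, and the final remainder is tested at the scale index just below that of
  \<open>s\<close>.\<close>

lemma structured_random_decomposition:
  assumes f: "f \<in> unit_ball M" and Ls: "incseq Ls" and \<delta>: "0 < \<delta>" "1 < real C * \<delta>\<^sup>2"
  obtains i m s where "i < C" "m \<le> C" "structured M T j (Ls (Suc i)) \<eta> m s"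
    "\<And>\<sigma>. reducible M T j (Ls i) \<eta> \<sigma> \<Longrightarrow> \<bar>\<integral>x. (f x - s x) * \<sigma> x \<partial>M\<bar> \<le> \<delta>"
proof -
  have [measurable]: "f \<in> borel_measurable M" and f1: "\<bar>f x\<bar> \<le> 1" for x
    using unit_ballD[OF f] by auto
  \<comment> \<open>The procedure can stop after \<open>m\<close> moves, at scale index
    \<open>C - m\<close>, because the next lower index finds no correlation.\<close>
  define good where "good m \<longleftrightarrow> (\<exists>s. structured M T j (Ls (C - m)) \<eta> m s \<and>
      (\<forall>\<sigma>. reducible M T j (Ls (C - Suc m)) \<eta> \<sigma> \<longrightarrow> \<bar>\<integral>x. (f x - s x) * \<sigma> x \<partial>M\<bar> \<le> \<delta>))" for m
  have "(\<exists>m<k. good m) \<or>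
      (\<exists>s. structured M T j (Ls (C - k)) \<eta> k s \<and> (\<integral>x. (f x - s x)\<^sup>2 \<partial>M) \<le> 1 - real k * \<delta>\<^sup>2)" for k
  proof (induction k)
    case 0
    have "(f x)\<^sup>2 \<le> 1" for x using f1[of x] by (simp add: abs_square_le_1)
    then have "(\<integral>x. (f x)\<^sup>2 \<partial>M) \<le> 1"
      by (intro integral_le_bound) auto
    then show ?case using structured_0 by force
  next
    case (Suc k)
    show ?case
    proof (cases "\<exists>m<Suc k. good m")
      case False
      with Suc obtain s where s: "structured M T j (Ls (C - k)) \<eta> k s"
        and e: "(\<integral>x. (f x - s x)\<^sup>2 \<partial>M) \<le> 1 - real k * \<delta>\<^sup>2"
        using less_Suc_eq by blast
      from False have "\<not> good k" by blast
      with s obtain \<sigma> where \<sigma>: "reducible M T j (Ls (C - Suc k)) \<eta> \<sigma>"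
        and c: "\<not> \<bar>\<integral>x. (f x - s x) * \<sigma> x \<partial>M\<bar> \<le> \<delta>"
        unfolding good_def by blast
      have [measurable]: "s \<in> borel_measurable M" using s by (rule structured_measurable)
      have "\<bar>f x - s x\<bar> \<le> 1 + real k" for x
        using f1[of x] structured_bound[OF s, of x] by linarith
      moreover have "\<sigma> \<in> unit_ball M" using \<sigma> by (simp add: reducible_def)
      ultimately obtain a where a: "\<bar>a\<bar> \<le> 1"
        "(\<integral>x. (f x - s x - a * \<sigma> x)\<^sup>2 \<partial>M) \<le> 1 - real k * \<delta>\<^sup>2 - \<delta>\<^sup>2"
        using energy_decrement[of "\<lambda>x. f x - s x" "1 + real k" \<sigma> "1 - real k * \<delta>\<^sup>2" \<delta>] e c \<delta>(1)
        by auto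
      have "structured M T j (Ls (C - Suc k)) \<eta> k s"
        using s Ls by (auto elim!: structured_mono intro: incseqD)
      from structured_Suc[OF this \<sigma> a(1)] a(2) show ?thesis
        by (intro disjI2 exI[of _ "\<lambda>x. s x + a * \<sigma> x"]) (simp add: algebra_simps)
    qed simp
  qed
  \<comment> \<open>\<open>C\<close> moves would leave negative energy, as
    \<open>1 < real C * \<delta>\<^sup>2\<close>.\<close>
  from this[of C] have "\<exists>m<C. good m"
  proof
    assume "\<exists>s. structured M T j (Ls (C - C)) \<eta> C s \<and> (\<integral>x. (f x - s x)\<^sup>2 \<partial>M) \<le> 1 - real C * \<delta>\<^sup>2"
    then obtain s where "(\<integral>x. (f x - s x)\<^sup>2 \<partial>M) \<le> 1 - real C * \<delta>\<^sup>2" by blast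
    moreover have "0 \<le> (\<integral>x. (f x - s x)\<^sup>2 \<partial>M)" by simp
    ultimately show ?thesis using \<delta>(2) by linarith
  qed
  then obtain m s where "m < C" "structured M T j (Ls (C - m)) \<eta> m s"
    "\<forall>\<sigma>. reducible M T j (Ls (C - Suc m)) \<eta> \<sigma> \<longrightarrow> \<bar>\<integral>x. (f x - s x) * \<sigma> x \<partial>M\<bar> \<le> \<delta>"
    unfolding good_def by blast
  then show thesis
    using that[of "C - Suc m" m s] by (auto simp: Suc_diff_Suc)
qed

end

section \<open>Parametrised families\<close>

text \<open>A family of functions indexed by natural numbers is a single function on the product
  with the parameter space. The parameter is frozen, so averages are formed separately in each
  fibre.\<close>

definition lift_map :: "(nat \<Rightarrow> 'a \<Rightarrow> 'a) \<Rightarrow> nat \<Rightarrow> 'a \<times> nat \<Rightarrow> 'a \<times> nat" where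
  "lift_map T i y = (T i (fst y), snd y)"

lemma lift_map_pow: "(lift_map T i ^^ n) y = ((T i ^^ n) (fst y), snd y)"
  by (induction n) (auto simp: lift_map_def)

section \<open>Commuting systems on products with a parameter space\<close>

context commuting_system
begin

lemma distr_lift_map:
  "distr (M \<Otimes>\<^sub>M measure_pmf p) (M \<Otimes>\<^sub>M measure_pmf p) (lift_map T i) = M \<Otimes>\<^sub>M measure_pmf p"
proof -
  have "M \<Otimes>\<^sub>M measure_pmf p = distr M M (T i) \<Otimes>\<^sub>M distr (measure_pmf p) (measure_pmf p) (\<lambda>k. k)"
    by (simp add: distr_T)
  also have "\<dots> = distr (M \<Otimes>\<^sub>M measure_pmf p) (M \<Otimes>\<^sub>M measure_pmf p) (\<lambda>(x, k). (T i x, k))"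
    by (rule pair_measure_distr) (auto simp: measure_pmf.sigma_finite_measure_axioms)
  also have "(\<lambda>(x, k). (T i x, k)) = lift_map T i"
    by (auto simp: lift_map_def fun_eq_iff)
  finally show ?thesis ..
qed

lemma commuting_system_lift:
  "commuting_system (M \<Otimes>\<^sub>M measure_pmf p) (lift_map T) (lift_map R)"
proof -
  interpret P: pair_prob_space M "measure_pmf p"
    by (intro pair_prob_space.intro pair_sigma_finite.intro prob_space_axioms sigma_finite_measure_axioms
          measure_pmf.prob_space_axioms measure_pmf.sigma_finite_measure_axioms)
  show ?thesis
  proof
    show "lift_map T i \<in> M \<Otimes>\<^sub>M measure_pmf p \<rightarrow>\<^sub>M M \<Otimes>\<^sub>M measure_pmf p" for i
      unfolding lift_map_def[abs_def] by measurable
    show "lift_map R i \<in> M \<Otimes>\<^sub>M measure_pmf p \<rightarrow>\<^sub>M M \<Otimes>\<^sub>M measure_pmf p" for i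
      unfolding lift_map_def[abs_def] by measurable
  qed (auto simp: lift_map_def R_T T_R T_commute distr_lift_map)
qed

end

text \<open>The triple consists of the old parameter \<kappa>, the number \<open>t\<close> of a
  structured term and the variable \<open>m\<close> of the mean representing that term. Coding it as
  one natural number keeps the parameter type fixed throughout the induction on
  \<open>j\<close>.\<close>

definition mixture :: "nat pmf \<Rightarrow> nat \<Rightarrow> (nat \<Rightarrow> nat pmf) \<Rightarrow> nat pmf" where
  "mixture p C q = p \<bind> (\<lambda>\<kappa>. pmf_of_set {..<C} \<bind>
     (\<lambda>t. map_pmf (\<lambda>m. prod_encode (\<kappa>, prod_encode (t, m))) (q t)))"

lemma
  assumes p: "finite (set_pmf p)" and C: "0 < C" and q: "\<And>t. finite (set_pmf (q t))"
  shows finite_mixture: "finite (set_pmf (mixture p C q))"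
    and integral_mixture: "(\<integral>\<kappa>. h \<kappa> \<partial>mixture p C q) =
      (\<integral>\<kappa>. (\<Sum>t<C. \<integral>m. h (prod_encode (\<kappa>, prod_encode (t, m))) \<partial>q t) / real C \<partial>p)"
proof -
  have ne: "{..<C} \<noteq> {}" using C by auto
  show "finite (set_pmf (mixture p C q))"
    using p q ne by (auto simp: mixture_def)
  show "(\<integral>\<kappa>. h \<kappa> \<partial>mixture p C q) =
      (\<integral>\<kappa>. (\<Sum>t<C. \<integral>m. h (prod_encode (\<kappa>, prod_encode (t, m))) \<partial>q t) / real C \<partial>p)"
    unfolding mixture_def using p q ne
    by (subst pmf_expectation_bind[of "set_pmf p"], simp, simp, simp,
        subst pmf_expectation_bind_pmf_of_set, simp, simp, simp,
        subst integral_measure_pmf[of "set_pmf p" p])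
       (simp_all add: sum_distrib_left divide_inverse mult.commute)
qed

lemma abs_integral_pmf_le:
  fixes g :: "nat \<Rightarrow> real"
  assumes "finite (set_pmf q)" "\<And>m. \<bar>f m\<bar> \<le> g m"
  shows "\<bar>\<integral>m. f m \<partial>measure_pmf q\<bar> \<le> (\<integral>m. g m \<partial>measure_pmf q)"
proof -
  have "\<bar>\<integral>m. f m \<partial>measure_pmf q\<bar> \<le> (\<integral>m. \<bar>f m\<bar> \<partial>measure_pmf q)" by (rule integral_abs_bound)
  also have "\<dots> \<le> (\<integral>m. g m \<partial>measure_pmf q)"
    by (rule integral_mono) (auto intro: integrable_measure_pmf_finite assms)
  finally show ?thesis .
qed

section \<open>Measurability and integration on the product with the parameter space\<close>

context prob_space
begin

abbreviation fibre :: "nat pmf \<Rightarrow> ('a \<times> nat) measure" where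
  "fibre p \<equiv> M \<Otimes>\<^sub>M measure_pmf p"

lemma prob_space_fibre: "prob_space (fibre p)"
proof -
  interpret P: pair_prob_space M "measure_pmf p"
    by (intro pair_prob_space.intro pair_sigma_finite.intro prob_space_axioms sigma_finite_measure_axioms
          measure_pmf.prob_space_axioms measure_pmf.sigma_finite_measure_axioms)
  show ?thesis by (rule P.prob_space_axioms)
qed

lemma measurable_fibreI:
  assumes "\<And>\<kappa>. (\<lambda>x. f (x, \<kappa>)) \<in> borel_measurable M"
  shows "f \<in> borel_measurable (fibre p)"
proof -
  have "(\<lambda>y. (\<lambda>\<kappa> y. f (fst y, \<kappa>)) (snd y) y) \<in> borel_measurable (fibre p)"
  proof (rule measurable_compose_countable)
    show "(\<lambda>y. f (fst y, \<kappa>)) \<in> borel_measurable (fibre p)" for \<kappa>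
      by (rule measurable_compose[OF measurable_fst assms])
    have "snd \<in> fibre p \<rightarrow>\<^sub>M measure_pmf p" by (rule measurable_snd)
    then show "snd \<in> fibre p \<rightarrow>\<^sub>M count_space UNIV" by simp
  qed
  then show ?thesis by simp
qed

lemma measurable_fibreD: "f \<in> borel_measurable (fibre p) \<Longrightarrow> (\<lambda>x. f (x, \<kappa>)) \<in> borel_measurable M"
  by (rule measurable_compose[of "\<lambda>x. (x, \<kappa>)" M "fibre p"]) auto

lemma unit_ball_fibre:
  "f \<in> unit_ball (fibre p) \<longleftrightarrow> (\<forall>\<kappa>. (\<lambda>x. f (x, \<kappa>)) \<in> unit_ball M)"
  by (auto simp: unit_ball_def intro: measurable_fibreI measurable_fibreD)

lemma integral_fibre:
  fixes f :: "'a \<times> nat \<Rightarrow> real"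
  assumes "f \<in> borel_measurable (fibre p)" "\<And>y. \<bar>f y\<bar> \<le> B"
  shows "(\<integral>y. f y \<partial>fibre p) = (\<integral>x. \<integral>\<kappa>. f (x, \<kappa>) \<partial>p \<partial>M)"
proof -
  interpret P: pair_prob_space M "measure_pmf p"
    by (intro pair_prob_space.intro pair_sigma_finite.intro prob_space_axioms sigma_finite_measure_axioms
          measure_pmf.prob_space_axioms measure_pmf.sigma_finite_measure_axioms)
  have "integrable (fibre p) f"
    by (rule P.integrable_bounded) (use assms in auto)
  from P.integral_fst'[OF this] show ?thesis by simp
qed

lemma measurable_fibre_integral:
  assumes "\<And>\<kappa>. (\<lambda>x. h (x, \<kappa>)) \<in> borel_measurable M" "finite (set_pmf q)"
  shows "(\<lambda>y. \<integral>m. h (fst y, e (snd y) m) \<partial>measure_pmf q :: real) \<in> borel_measurable (fibre p)"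
  by (subst integral_measure_pmf[of "set_pmf q"])
     (auto simp: assms(2) intro!: measurable_fibreI borel_measurable_sum borel_measurable_times assms(1))

text \<open>The choice of \<open>t\<close> in \<open>mixture\<close> is uniform, hence the factor
  \<open>C\<close> between the sum over \<open>t\<close> and the mean. This turns a pointwise bound
  by such a sum into an average over a larger parameter space.\<close>

lemma integral_fibre_mixture:
  fixes h :: "'a \<times> nat \<Rightarrow> real"
  assumes p: "finite (set_pmf p)" and C: "0 < C" and q: "\<And>t. finite (set_pmf (q t))"
    and h: "\<And>\<kappa>. (\<lambda>x. h (x, \<kappa>)) \<in> borel_measurable M" and B: "\<And>y. \<bar>h y\<bar> \<le> B"
  defines "H \<equiv> \<lambda>t y. \<integral>m. h (fst y, prod_encode (snd y, prod_encode (t, m))) \<partial>q t"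
  shows "(\<integral>y. (\<Sum>t<C. H t y) \<partial>fibre p) = real C * (\<integral>y. h y \<partial>fibre (mixture p C q))"
    and "integrable (fibre p) (\<lambda>y. \<Sum>t<C. H t y)"
proof -
  interpret P: prob_space "fibre p" by (rule prob_space_fibre)
  have HB: "\<bar>H t y\<bar> \<le> B" for t y
    unfolding H_def using abs_integral_pmf_le[OF q, of "\<lambda>m. h (fst y, prod_encode (snd y, prod_encode (t, m)))" "\<lambda>_. B" t] B
    by simp
  have Hm: "H t \<in> borel_measurable (fibre p)" for t
    unfolding H_def by (rule measurable_fibre_integral[OF h q])
  have SB: "\<bar>\<Sum>t<C. H t y\<bar> \<le> real C * B" for y
    using order_trans[OF sum_abs sum_mono[of "{..<C}" "\<lambda>t. \<bar>H t y\<bar>" "\<lambda>_. B"]] HB by simp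
  have Sm: "(\<lambda>y. \<Sum>t<C. H t y) \<in> borel_measurable (fibre p)"
    using Hm by (intro borel_measurable_sum)
  show "integrable (fibre p) (\<lambda>y. \<Sum>t<C. H t y)"
    by (rule P.integrable_bounded[OF Sm SB])
  have "(\<integral>y. h y \<partial>fibre (mixture p C q)) = (\<integral>x. \<integral>\<kappa>. h (x, \<kappa>) \<partial>mixture p C q \<partial>M)"
    by (rule integral_fibre[OF measurable_fibreI[OF h] B])
  also have "\<dots> = (\<integral>x. (\<integral>\<kappa>. (\<Sum>t<C. H t (x, \<kappa>)) \<partial>p) / real C \<partial>M)"
    using integral_mixture[OF p C q] by (simp add: H_def)
  also have "\<dots> = (\<integral>y. (\<Sum>t<C. H t y) \<partial>fibre p) / real C"
    using integral_fibre[OF Sm SB] by simp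
  finally show "(\<integral>y. (\<Sum>t<C. H t y) \<partial>fibre p) = real C * (\<integral>y. h y \<partial>fibre (mixture p C q))"
    using C by simp
qed

end

section \<open>Transfer to one transformation fewer\<close>

context commuting_system
begin

abbreviation lavg :: "nat \<Rightarrow> (nat \<Rightarrow> 'a \<times> nat \<Rightarrow> real) \<Rightarrow> nat \<Rightarrow> 'a \<times> nat \<Rightarrow> real" where
  "lavg j f N y \<equiv> multi_avg (lift_map T) j f N y"

text \<open>Replacing the last function by a structured one turns the average over \<open>j + 1\<close>
  transformations into averages over \<open>j\<close> transformations with an additional parameter,
  which is absorbed into the second component of the enlarged space.\<close>

lemma structured_transfer:
  assumes p: "finite (set_pmf p)" and f: "\<And>i. f i \<in> unit_ball (fibre p)"
    and s: "structured (fibre p) (lift_map T) j B \<eta> k s" and C: "0 < C" "k \<le> C" and \<eta>: "0 \<le> \<eta>"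
  obtains p' f' where "finite (set_pmf p')" "\<And>i. f' i \<in> unit_ball (fibre p')"
    "\<And>N N'. N \<le> Suc B \<Longrightarrow> N' \<le> Suc B \<Longrightarrow>
      (\<integral>y. \<bar>lavg (Suc j) (f(Suc j := s)) N y - lavg (Suc j) (f(Suc j := s)) N' y\<bar> \<partial>fibre p)
        \<le> 2 * real C * \<eta> + real C * (\<integral>y. \<bar>lavg j f' N y - lavg j f' N' y\<bar> \<partial>fibre p')"
proof -
  let ?S = "lift_map T"
  interpret L: commuting_system "fibre p" ?S "lift_map R" by (rule commuting_system_lift)
  obtain c \<sigma> where s_eq: "s = (\<lambda>x. \<Sum>t<k. c t * \<sigma> t x)"
    and c: "\<And>t. t < k \<Longrightarrow> \<bar>c t\<bar> \<le> 1" and red: "\<And>t. t < k \<Longrightarrow> reducible (fibre p) ?S j B \<eta> (\<sigma> t)"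
    using s unfolding structured_def by blast
  \<comment> \<open>Only \<open>t < k\<close> is constrained by the approximation:
    \<open>mixture\<close> draws \<open>t\<close> from all numbers below \<open>C\<close>, and for
    the surplus indices any bounded data will do.\<close>
  define rep where "rep t q b \<longleftrightarrow> finite (set_pmf q) \<and> (\<forall>i m. b i m \<in> unit_ball (fibre p)) \<and>
       (t < k \<longrightarrow> (\<forall>l\<le>B. \<forall>x. \<bar>\<sigma> t ((?S (Suc j) ^^ l) x) -
          (\<integral>m. b 0 m x * (\<Prod>i=1..j. b i m ((?S i ^^ l) x)) \<partial>q)\<bar> \<le> \<eta>))"
    for t and q :: "nat pmf" and b
  have "\<exists>q b. rep t q b" for t
  proof (cases "t < k")
    case True
    then show ?thesis using red unfolding reducible_def rep_def by blast
  next
    case False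
    then show ?thesis unfolding rep_def
      by (intro exI[of _ "return_pmf 0"] exI[of _ "\<lambda>_ _ _. 0"]) (auto simp: unit_ball_def)
  qed
  then obtain q b where rep: "\<And>t. rep t (q t) (b t)" by metis
  then have q: "\<And>t. finite (set_pmf (q t))"
    and b: "\<And>t i m. b t i m \<in> unit_ball (fibre p)"
    and approx: "\<And>t l x. t < k \<Longrightarrow> l \<le> B \<Longrightarrow> \<bar>\<sigma> t ((?S (Suc j) ^^ l) x) -
          (\<integral>m. b t 0 m x * (\<Prod>i=1..j. b t i m ((?S i ^^ l) x)) \<partial>q t)\<bar> \<le> \<eta>"
    unfolding rep_def by blast+
  \<comment> \<open>A new parameter codes \<kappa>, \<open>t\<close> and \<open>m\<close>. The
    functions \<open>f i\<close> and \<open>b t i m\<close> are merged because both are evaluated at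
    the same iterate; \<open>b t 0 m\<close> is not shifted and stays outside as a weight bounded by
    1.\<close>
  define f' where "f' i y = (case prod_decode (snd y) of (\<kappa>, u) \<Rightarrow> case prod_decode u of (t, m) \<Rightarrow>
      f i (fst y, \<kappa>) * b t i m (fst y, \<kappa>))" for i and y :: "'a \<times> nat"
  define e where "e y t m = (fst y, prod_encode (snd y, prod_encode (t, m)))"
    for y :: "'a \<times> nat" and t m :: nat
  have f'_e: "f' i (e y t m) = f i y * b t i m y" for i y t m
    by (simp add: f'_def e_def)
  have pow_e: "(?S i ^^ n) (e y t m) = e ((?S i ^^ n) y) t m" for i n y t m
    by (simp add: lift_map_pow e_def)
  have f': "f' i \<in> unit_ball (fibre p')" for i p'
    unfolding unit_ball_fibre
  proof
    fix \<kappa>' :: nat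
    obtain \<kappa> t m where "\<kappa>' = prod_encode (\<kappa>, prod_encode (t, m))"
      by (metis prod_decode_inverse surj_pair)
    then have "(\<lambda>x. f' i (x, \<kappa>')) = (\<lambda>x. f i (x, \<kappa>) * b t i m (x, \<kappa>))"
      by (simp add: f'_def)
    then show "(\<lambda>x. f' i (x, \<kappa>')) \<in> unit_ball M"
      using f[of i] b[of t i m] unfolding unit_ball_fibre by (simp add: unit_ball_mult)
  qed
  have finq: "integrable (measure_pmf (q t)) g" for t and g :: "nat \<Rightarrow> real"
    by (intro integrable_measure_pmf_finite q)
  define main where "main N y = (\<Sum>t<k. c t * (\<integral>m. b t 0 m y * lavg j f' N (e y t m) \<partial>q t))" for N y
  \<comment> \<open>The times satisfy \<open>n < N\<close>, so \<open>N \<le> Suc B\<close> keeps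
    them in the range \<open>n \<le> B\<close> where the approximation holds. Each of the at most
    \<open>C\<close> terms contributes an error of at most \<eta>.\<close>
  have close: "\<bar>lavg (Suc j) (f(Suc j := s)) N y - main N y\<bar> \<le> real C * \<eta>" if N: "N \<le> Suc B" for N y
  proof -
    define P where "P n = (\<Prod>i=1..j. f i ((?S i ^^ n) y))" for n
    define I where "I n t = (\<integral>m. b t 0 m y * (\<Prod>i=1..j. b t i m ((?S i ^^ n) y)) \<partial>q t)" for n t
    have P1: "\<bar>P n\<bar> \<le> 1" for n unfolding P_def by (intro abs_prod_le_1 unit_ballD(2)[OF f])
    have l: "lavg (Suc j) (f(Suc j := s)) N y = (\<Sum>n<N. P n * s ((?S (Suc j) ^^ n) y)) / real N"
      unfolding multi_avg_def P_def by (auto intro!: sum.cong prod.cong arg_cong2[where f="(/)"])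
    have "(\<integral>m. b t 0 m y * lavg j f' N (e y t m) \<partial>q t) = (\<Sum>n<N. P n * I n t) / real N" for t
    proof -
      have "b t 0 m y * lavg j f' N (e y t m)
          = (\<Sum>n<N. P n * (b t 0 m y * (\<Prod>i=1..j. b t i m ((?S i ^^ n) y)))) / real N" for m
        by (simp add: multi_avg_def pow_e f'_e prod.distrib P_def sum_distrib_left algebra_simps)
      then show ?thesis by (simp add: finq I_def)
    qed
    then have "main N y = (\<Sum>t<k. \<Sum>n<N. c t * (P n * I n t)) / real N"
      by (simp add: main_def sum_distrib_left sum_divide_distrib)
    also have "\<dots> = (\<Sum>n<N. P n * (\<Sum>t<k. c t * I n t)) / real N"
      by (subst sum.swap) (simp add: sum_distrib_left algebra_simps)
    finally have m: "main N y = (\<Sum>n<N. P n * (\<Sum>t<k. c t * I n t)) / real N" .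
    have "\<bar>P n * s ((?S (Suc j) ^^ n) y) - P n * (\<Sum>t<k. c t * I n t)\<bar> \<le> real C * \<eta>" if "n < N" for n
    proof -
      have "\<bar>s ((?S (Suc j) ^^ n) y) - (\<Sum>t<k. c t * I n t)\<bar>
          = \<bar>\<Sum>t<k. c t * (\<sigma> t ((?S (Suc j) ^^ n) y) - I n t)\<bar>"
        by (simp add: s_eq sum_subtractf algebra_simps)
      also have "\<dots> \<le> (\<Sum>t<k. \<eta>)"
      proof (rule sum_abs[THEN order_trans], rule sum_mono)
        fix t assume "t \<in> {..<k}"
        then have "\<bar>c t\<bar> \<le> 1" "\<bar>\<sigma> t ((?S (Suc j) ^^ n) y) - I n t\<bar> \<le> \<eta>"
          using c approx[of t n y] \<open>n < N\<close> N by (auto simp: I_def)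
        from mult_mono[OF this] show "\<bar>c t * (\<sigma> t ((?S (Suc j) ^^ n) y) - I n t)\<bar> \<le> \<eta>"
          by (simp add: abs_mult)
      qed
      also have "\<dots> \<le> real C * \<eta>" using C \<eta> by (simp add: mult_right_mono)
      finally have "\<bar>s ((?S (Suc j) ^^ n) y) - (\<Sum>t<k. c t * I n t)\<bar> \<le> real C * \<eta>" .
      from mult_mono[OF P1[of n] this] show ?thesis
        by (simp add: abs_mult right_diff_distrib[symmetric])
    qed
    then have "\<bar>\<Sum>n<N. P n * s ((?S (Suc j) ^^ n) y) - P n * (\<Sum>t<k. c t * I n t)\<bar> \<le> (\<Sum>n<N. real C * \<eta>)"
      by (intro sum_abs[THEN order_trans] sum_mono) auto
    then have "\<bar>(\<Sum>n<N. P n * s ((?S (Suc j) ^^ n) y) - P n * (\<Sum>t<k. c t * I n t)) / real N\<bar> \<le> real C * \<eta>"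
      using \<eta> by (cases "N = 0") (simp_all add: divide_le_eq mult.commute)
    then show ?thesis unfolding l m by (simp only: sum_subtractf diff_divide_distrib)
  qed
  show thesis
  proof (rule that[of "mixture p C q" f'])
    show "finite (set_pmf (mixture p C q))" by (rule finite_mixture[OF p C(1) q])
    show "f' i \<in> unit_ball (fibre (mixture p C q))" for i by (rule f')
    fix N N' assume N: "N \<le> Suc B" "N' \<le> Suc B"
    let ?f = "f(Suc j := s)"
    define h where "h y = \<bar>lavg j f' N y - lavg j f' N' y\<bar>" for y
    \<comment> \<open>Sections at a fixed parameter do not depend on the parameter law, so a point
      mass suffices for their measurability and bounds.\<close>
    interpret Q: commuting_system "fibre (return_pmf 0)" ?S "lift_map R" by (rule commuting_system_lift)
    have avg1: "lavg j f' n \<in> unit_ball (fibre (return_pmf 0))" for n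
      by (rule Q.multi_avg_unit_ball[OF f'])
    then have hm: "(\<lambda>x. h (x, \<kappa>)) \<in> borel_measurable M" for \<kappa>
      unfolding h_def by (intro borel_measurable_abs borel_measurable_diff measurable_fibreD unit_ballD)
    have hB: "\<bar>h y\<bar> \<le> 2" for y
      using unit_ballD(2)[OF avg1, of N y] unit_ballD(2)[OF avg1, of N' y] by (simp add: h_def)
    define H where "H y = (\<Sum>t<C. \<integral>m. h (fst y, prod_encode (snd y, prod_encode (t, m))) \<partial>q t)" for y
    note mix = integral_fibre_mixture[where q=q, OF p C(1) q hm hB, folded H_def]
    have fm: "?f i \<in> borel_measurable (fibre p)" for i
      using structured_measurable[OF s] unit_ballD(1)[OF f] by (cases "i = Suc j") auto
    have am: "lavg (Suc j) ?f n \<in> borel_measurable (fibre p)" for n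
      by (rule L.measurable_multi_avg[OF fm])
    have bound: "\<bar>lavg (Suc j) ?f N y - lavg (Suc j) ?f N' y\<bar> \<le> 2 * real C * \<eta> + H y" for y
    proof -
      have "main N y - main N' y
          = (\<Sum>t<k. c t * (\<integral>m. b t 0 m y * (lavg j f' N (e y t m) - lavg j f' N' (e y t m)) \<partial>q t))"
        by (simp add: main_def sum_subtractf[symmetric] right_diff_distrib finq)
      also have "\<bar>\<dots>\<bar> \<le> (\<Sum>t<k. \<integral>m. h (e y t m) \<partial>q t)"
      proof (rule sum_abs[THEN order_trans], rule sum_mono)
        fix t assume "t \<in> {..<k}"
        then have ct: "\<bar>c t\<bar> \<le> 1" using c by simp
        have "\<bar>\<integral>m. b t 0 m y * (lavg j f' N (e y t m) - lavg j f' N' (e y t m)) \<partial>q t\<bar>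
            \<le> (\<integral>m. h (e y t m) \<partial>q t)"
        proof (rule abs_integral_pmf_le[OF q])
          show "\<bar>b t 0 m y * (lavg j f' N (e y t m) - lavg j f' N' (e y t m))\<bar> \<le> h (e y t m)" for m
            using mult_right_mono[OF unit_ballD(2)[OF b, of t 0 m y], of "h (e y t m)"]
            by (simp add: abs_mult h_def)
        qed
        from mult_mono[OF ct this]
        show "\<bar>c t * (\<integral>m. b t 0 m y * (lavg j f' N (e y t m) - lavg j f' N' (e y t m)) \<partial>q t)\<bar>
            \<le> (\<integral>m. h (e y t m) \<partial>q t)" by (simp add: abs_mult)
      qed
      \<comment> \<open>The integrals of \<open>h\<close> are nonnegative, so the sum may be
        extended from \<open>t < k\<close> to \<open>t < C\<close>, the range of
        \<open>mixture\<close>.\<close>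
      also have "\<dots> \<le> H y"
        unfolding H_def e_def using C
        by (intro sum_mono2) (auto intro!: integral_nonneg_AE simp: h_def)
      finally show ?thesis using close[OF N(1), of y] close[OF N(2), of y] by linarith
    qed
    have "(\<integral>y. \<bar>lavg (Suc j) ?f N y - lavg (Suc j) ?f N' y\<bar> \<partial>fibre p)
        \<le> (\<integral>y. 2 * real C * \<eta> + H y \<partial>fibre p)"
    proof (rule integral_mono')
      show "integrable (fibre p) (\<lambda>y. 2 * real C * \<eta> + H y)" using mix(2) by simp
    qed (use bound in \<open>auto intro: order_trans[OF abs_ge_zero bound]\<close>)
    also have "\<dots> = 2 * real C * \<eta> + real C * (\<integral>y. h y \<partial>fibre (mixture p C q))"
      using mix by (simp add: L.prob_space)
    finally show "(\<integral>y. \<bar>lavg (Suc j) ?f N y - lavg (Suc j) ?f N' y\<bar> \<partial>fibre p)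
        \<le> 2 * real C * \<eta> + real C * (\<integral>y. \<bar>lavg j f' N y - lavg j f' N' y\<bar> \<partial>fibre (mixture p C q))"
      by (simp add: h_def)
  qed
qed

section \<open>Metastability\<close>

definition stable_on ::
  "nat pmf \<Rightarrow> nat \<Rightarrow> (nat \<Rightarrow> 'a \<times> nat \<Rightarrow> real) \<Rightarrow> real \<Rightarrow> nat \<Rightarrow> nat \<Rightarrow> bool" where
  "stable_on p j f \<epsilon> a b \<longleftrightarrow> (\<forall>N\<in>{a..b}. \<forall>N'\<in>{a..b}.
     (\<integral>y. \<bar>lavg j f N y - lavg j f N' y\<bar> \<partial>fibre p) \<le> \<epsilon>)"

definition admissible :: "nat pmf \<Rightarrow> (nat \<Rightarrow> 'a \<times> nat \<Rightarrow> real) \<Rightarrow> bool" where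
  "admissible p f \<longleftrightarrow> finite (set_pmf p) \<and> (\<forall>i. f i \<in> unit_ball (fibre p))"

text \<open>The bound \<open>K\<close> does not depend on the parameter distribution \<open>p\<close>: this uniformity is what
  makes the induction on \<open>j\<close> possible.\<close>

definition metastable :: "nat \<Rightarrow> bool" where
  "metastable j \<longleftrightarrow> (\<forall>\<epsilon>>0. \<forall>F :: nat \<Rightarrow> nat. \<exists>K. \<forall>p f. admissible p f \<longrightarrow>
     (\<exists>n\<le>K. stable_on p j f \<epsilon> n (F n)))"

lemma stable_on_mono: "stable_on p j f \<epsilon> a b \<Longrightarrow> a \<le> a' \<Longrightarrow> b' \<le> b \<Longrightarrow> stable_on p j f \<epsilon> a' b'"
  by (auto simp: stable_on_def)

lemma metastable_0: "metastable 0"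
proof -
  \<comment> \<open>For \<open>N = 0\<close> division by zero gives the value 0 instead of 1, so the
    window is started at \<open>n = 1\<close>.\<close>
  have "multi_avg S 0 f N y = 1" if "1 \<le> N" for S and f :: "nat \<Rightarrow> 'a \<times> nat \<Rightarrow> real" and N y
    using that by (simp add: multi_avg_def)
  then show ?thesis unfolding metastable_def stable_on_def
    by (intro allI impI exI[of _ 1]) auto
qed

text \<open>Metastability is applied to \<open>F (max n n0)\<close>, and the window found is
  shortened to begin at \<open>max n n0\<close>.\<close>

lemma metastable_from:
  assumes "metastable j" "0 < \<epsilon>"
  shows "\<exists>K. \<forall>p f. admissible p f \<longrightarrow> (\<exists>n. n0 \<le> n \<and> n \<le> K \<and> stable_on p j f \<epsilon> n (F n))"
proof -
  obtain K where K: "\<And>p f. admissible p f \<Longrightarrow> \<exists>n\<le>K. stable_on p j f \<epsilon> n (F (max n n0))"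
    using assms unfolding metastable_def by meson
  show ?thesis
  proof (rule exI[of _ "max K n0"], intro allI impI)
    fix p f assume "admissible p f"
    from K[OF this] obtain n where n: "n \<le> K" "stable_on p j f \<epsilon> n (F (max n n0))" by blast
    then show "\<exists>n. n0 \<le> n \<and> n \<le> max K n0 \<and> stable_on p j f \<epsilon> n (F n)"
      by (intro exI[of _ "max n n0"]) (auto elim: stable_on_mono)
  qed
qed

text \<open>The last function splits into \<open>s\<close> and \<open>r\<close> at some scale index
  \<open>i\<close>. From \<open>start (Ls i)\<close> on, averages with \<open>r\<close> are small;
  up to \<open>Suc (Ls (Suc i))\<close>, averages with \<open>s\<close> are controlled by averages
  over \<open>j\<close> transformations. The scales grow fast enough for the induction hypothesis to
  place its whole window between these two bounds.\<close>

lemma metastable_Suc: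
  assumes IH: "metastable j"
  shows "metastable (Suc j)"
  unfolding metastable_def
proof (intro allI impI)
  fix \<epsilon> :: real and F :: "nat \<Rightarrow> nat"
  assume \<epsilon>: "0 < \<epsilon>"
  \<comment> \<open>Five portions of \<delta> are spent: two on the random part, for
    \<open>N\<close> and \<open>N'\<close>, two on approximating the structured part and one on the
    induction hypothesis, since \<open>real C * \<eta> = \<delta>\<close>.\<close>
  define \<delta> where "\<delta> = \<epsilon> / 5"
  have \<delta>: "0 < \<delta>" using \<epsilon> by (simp add: \<delta>_def)
  obtain C :: nat where C: "1 / \<delta>\<^sup>2 < real C" using reals_Archimedean2 by blast
  then have C\<delta>: "1 < real C * \<delta>\<^sup>2" using \<delta> by (simp add: field_simps)
  then have C0: "0 < C" by (cases C) auto
  define \<eta> where "\<eta> = \<delta> / real C"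
  have \<eta>: "0 < \<eta>" using \<delta> C0 by (simp add: \<eta>_def)
  \<comment> \<open>This encodes the conditions of \<open>multi_avg_random_le\<close> on
    \<open>N\<close>; \<open>Suc\<close> supplies \<open>0 < N\<close> even for
    \<open>L = 0\<close>.\<close>
  define start where "start L = max (Suc L) (nat \<lceil>2 * real L / \<eta>\<rceil>)" for L
  have start: "0 < N" "L \<le> N" "2 * real L \<le> \<eta> * real N" if "start L \<le> N" for L N
  proof -
    have "2 * real L / \<eta> \<le> real N" using that by (auto simp: start_def nat_le_iff ceiling_le_iff)
    then show "2 * real L \<le> \<eta> * real N" using \<eta> by (simp add: divide_le_eq mult.commute)
  qed (use that in \<open>auto simp: start_def\<close>)
  have "\<forall>L. \<exists>K. \<forall>p f. admissible p f \<longrightarrow> (\<exists>n. start L \<le> n \<and> n \<le> K \<and> stable_on p j f \<eta> n (F n))"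
    by (intro allI metastable_from[OF IH \<eta>])
  then obtain K where K: "\<And>L p f. admissible p f \<Longrightarrow>
      \<exists>n. start L \<le> n \<and> n \<le> K L \<and> stable_on p j f \<eta> n (F n)"
    unfolding choice_iff by blast
  \<comment> \<open>Large enough for \<open>F n\<close> at every possible window start
    \<open>n \<le> K L\<close>; inserting \<open>L\<close> makes the scales nondecreasing.\<close>
  define next_scale where "next_scale L = Max (insert L (F ` {..K L}))" for L
  have next_scale: "L \<le> next_scale L" "n \<le> K L \<Longrightarrow> F n \<le> next_scale L" for L n
    unfolding next_scale_def by (auto intro!: Max_ge simp del: Max_insert)
  define Ls where "Ls i = (next_scale ^^ i) 0" for i
  have Ls_Suc: "Ls (Suc i) = next_scale (Ls i)" for i by (simp add: Ls_def)
  have Ls: "incseq Ls" by (rule incseq_SucI) (simp add: Ls_Suc next_scale)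
  \<comment> \<open>The scales depend on neither \<open>p\<close> nor \<open>f\<close>, so a maximum
    over finitely many of them is a uniform bound, although the index \<open>i\<close> found later
    depends on both.\<close>
  define K' where "K' = Max ((\<lambda>i. K (Ls i)) ` {..C})"
  show "\<exists>K. \<forall>p f. admissible p f \<longrightarrow> (\<exists>n\<le>K. stable_on p (Suc j) f \<epsilon> n (F n))"
  proof (rule exI[of _ K'], intro allI impI)
    fix p f assume "admissible p f"
    then have p: "finite (set_pmf p)" and f: "f i \<in> unit_ball (fibre p)" for i
      by (auto simp: admissible_def)
    interpret L: commuting_system "fibre p" "lift_map T" "lift_map R" by (rule commuting_system_lift)
    obtain i m s where i: "i < C" "m \<le> C"
      and s: "structured (fibre p) (lift_map T) j (Ls (Suc i)) \<eta> m s"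
      and orth: "\<And>\<sigma>. reducible (fibre p) (lift_map T) j (Ls i) \<eta> \<sigma> \<Longrightarrow>
        \<bar>\<integral>x. (f (Suc j) x - s x) * \<sigma> x \<partial>fibre p\<bar> \<le> \<delta>"
      by (rule L.structured_random_decomposition[where T="lift_map T" and j=j and \<eta>=\<eta>, OF f[of "Suc j"] Ls \<delta> C\<delta>]) blast
    define r where "r x = f (Suc j) x - s x" for x
    obtain p' f' where p': "finite (set_pmf p')" and f': "\<And>i. f' i \<in> unit_ball (fibre p')"
      and transfer: "\<And>N N'. N \<le> Suc (Ls (Suc i)) \<Longrightarrow> N' \<le> Suc (Ls (Suc i)) \<Longrightarrow>
      (\<integral>y. \<bar>lavg (Suc j) (f(Suc j := s)) N y - lavg (Suc j) (f(Suc j := s)) N' y\<bar> \<partial>fibre p)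
        \<le> 2 * real C * \<eta> + real C * (\<integral>y. \<bar>lavg j f' N y - lavg j f' N' y\<bar> \<partial>fibre p')"
      by (rule structured_transfer[where f=f, OF p f s C0 i(2) less_imp_le[OF \<eta>]]) blast
    \<comment> \<open>\<open>p'\<close> and \<open>f'\<close> depend on the decomposition, but
      \<open>K\<close> does not: this is where uniformity over parameter distributions is
      used.\<close>
    obtain n where n: "start (Ls i) \<le> n" "n \<le> K (Ls i)"
      and stable: "\<And>N N'. N \<in> {n..F n} \<Longrightarrow> N' \<in> {n..F n} \<Longrightarrow>
        (\<integral>y. \<bar>lavg j f' N y - lavg j f' N' y\<bar> \<partial>fibre p') \<le> \<eta>"
      using K[of p' f' "Ls i"] p' f' unfolding admissible_def stable_on_def by blast
    have [measurable]: "s \<in> borel_measurable (fibre p)" using s by (rule structured_measurable)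
    have fm [measurable]: "f i \<in> borel_measurable (fibre p)" for i using f by (rule unit_ballD)
    have rm [measurable]: "r \<in> borel_measurable (fibre p)" unfolding r_def[abs_def] by measurable
    have rB: "\<bar>r x\<bar> \<le> 1 + real m" for x
      using unit_ballD(2)[OF f, of "Suc j" x] structured_bound[OF s, of x] by (simp add: r_def)
    have random: "(\<integral>y. \<bar>lavg (Suc j) (f(Suc j := r)) N y\<bar> \<partial>fibre p) \<le> \<delta>" if "n \<le> N" for N
    proof (rule L.multi_avg_random_le[where f=f, OF f rm rB])
      show "\<bar>\<integral>x. r x * \<sigma> x \<partial>fibre p\<bar> \<le> \<delta>"
        if "reducible (fibre p) (lift_map T) j (Ls i) \<eta> \<sigma>" for \<sigma>
        using orth[OF that] by (simp add: r_def)
    qed (use start[of "Ls i" N] n that in auto)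
    have split: "lavg (Suc j) f N y = lavg (Suc j) (f(Suc j := s)) N y + lavg (Suc j) (f(Suc j := r)) N y" for N y
    proof -
      have P: "(\<Prod>i=1..j. (f(Suc j := g)) i ((lift_map T i ^^ n) y)) = (\<Prod>i=1..j. f i ((lift_map T i ^^ n) y))"
        for g n by (intro prod.cong) auto
      have "lavg (Suc j) (f(Suc j := g)) N y =
          (\<Sum>n<N. (\<Prod>i=1..j. f i ((lift_map T i ^^ n) y)) * g ((lift_map T (Suc j) ^^ n) y)) / real N" for g
        by (simp add: multi_avg_def P[simplified])
      from this[of s] this[of r] this[of "f (Suc j)"] show ?thesis
        by (simp add: r_def right_diff_distrib sum_subtractf diff_divide_distrib)
    qed
    have int: "integrable (fibre p) (lavg (Suc j) (f(Suc j := g)) N)"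
      if [measurable]: "g \<in> borel_measurable (fibre p)" and g: "\<And>x. \<bar>g x\<bar> \<le> real (Suc m)" for g N
    proof -
      have gm: "(f(Suc j := g)) i \<in> borel_measurable (fibre p)" for i by (cases "i = Suc j") auto
      have "\<bar>lavg (Suc j) (f(Suc j := g)) N y\<bar> \<le> (\<Sum>n<N. real (Suc m)) / real N" for y
        unfolding multi_avg_def abs_divide abs_of_nat
      proof (intro divide_right_mono sum_abs[THEN order_trans] sum_mono)
        fix n
        let ?P = "\<Prod>i=1..j. (f(Suc j := g)) i ((lift_map T i ^^ n) y)"
        have "\<bar>?P\<bar> \<le> 1"
          by (intro abs_prod_le_1) (use unit_ballD(2)[OF f] in auto)
        from mult_mono[OF this g[of "(lift_map T (Suc j) ^^ n) y"]]
        show "\<bar>\<Prod>i=1..Suc j. (f(Suc j := g)) i ((lift_map T i ^^ n) y)\<bar> \<le> real (Suc m)"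
          by (simp add: abs_mult)
      qed simp
      then show ?thesis by (intro L.integrable_bounded L.measurable_multi_avg gm)
    qed
    have ints: "integrable (fibre p) (lavg (Suc j) (f(Suc j := s)) N)" for N
    proof (rule int)
      show "\<bar>s x\<bar> \<le> real (Suc m)" for x using structured_bound[OF s, of x] by simp
    qed measurable
    have intr: "integrable (fibre p) (lavg (Suc j) (f(Suc j := r)) N)" for N
    proof (rule int)
      show "\<bar>r x\<bar> \<le> real (Suc m)" for x using rB[of x] by simp
    qed measurable
    have "(\<integral>y. \<bar>lavg (Suc j) f N y - lavg (Suc j) f N' y\<bar> \<partial>fibre p) \<le> \<epsilon>"
      if N: "N \<in> {n..F n}" and N': "N' \<in> {n..F n}" for N N'
    proof -
      have NB: "N \<le> Suc (Ls (Suc i))" "N' \<le> Suc (Ls (Suc i))"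
        using N N' next_scale(2)[OF n(2)] by (auto simp: Ls_Suc)
      have "(\<integral>y. \<bar>lavg (Suc j) f N y - lavg (Suc j) f N' y\<bar> \<partial>fibre p)
          \<le> (\<integral>y. \<bar>lavg (Suc j) (f(Suc j := s)) N y - lavg (Suc j) (f(Suc j := s)) N' y\<bar>
              + \<bar>lavg (Suc j) (f(Suc j := r)) N y\<bar> + \<bar>lavg (Suc j) (f(Suc j := r)) N' y\<bar> \<partial>fibre p)"
        by (intro integral_mono integrable_abs Bochner_Integration.integrable_add
            Bochner_Integration.integrable_diff ints intr) (auto simp: split intr ints)
      also have "\<dots> = (\<integral>y. \<bar>lavg (Suc j) (f(Suc j := s)) N y - lavg (Suc j) (f(Suc j := s)) N' y\<bar> \<partial>fibre p)
              + (\<integral>y. \<bar>lavg (Suc j) (f(Suc j := r)) N y\<bar> \<partial>fibre p)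
              + (\<integral>y. \<bar>lavg (Suc j) (f(Suc j := r)) N' y\<bar> \<partial>fibre p)"
        using ints intr by simp
      also have "\<dots> \<le> (2 * real C * \<eta> + real C * \<eta>) + \<delta> + \<delta>"
      proof (intro add_mono random)
        have "real C * (\<integral>y. \<bar>lavg j f' N y - lavg j f' N' y\<bar> \<partial>fibre p') \<le> real C * \<eta>"
          by (intro mult_left_mono stable N N') simp
        then show "(\<integral>y. \<bar>lavg (Suc j) (f(Suc j := s)) N y - lavg (Suc j) (f(Suc j := s)) N' y\<bar> \<partial>fibre p)
            \<le> 2 * real C * \<eta> + real C * \<eta>"
          using transfer[OF NB] by linarith
      qed (use N N' in auto)
      also have "\<dots> = \<epsilon>" using C0 by (simp add: \<eta>_def \<delta>_def)
      finally show ?thesis .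
    qed
    moreover have "n \<le> K'"
      using n(2) i(1) by (auto simp: K'_def intro!: order_trans[OF n(2)] Max_ge)
    ultimately show "\<exists>n\<le>K'. stable_on p (Suc j) f \<epsilon> n (F n)"
      unfolding stable_on_def by blast
  qed
qed

lemma metastable: "metastable j"
  by (induction j) (auto intro: metastable_0 metastable_Suc)

end

section \<open>Convergence\<close>

text \<open>A subsequence whose successive L^1 distances are at most \<open>(1/2) ^ k\<close>
  converges almost everywhere. Dominated convergence makes this an L^1 limit, and the Cauchy
  property extends it to the full sequence.\<close>

lemma (in prob_space) L1_Cauchy_limit:
  assumes F: "\<And>N. F N \<in> unit_ball M"
    and Cauchy: "\<And>\<epsilon>. 0 < \<epsilon> \<Longrightarrow> \<exists>n. \<forall>N\<ge>n. \<forall>N'\<ge>n. (\<integral>x. \<bar>F N x - F N' x\<bar> \<partial>M) \<le> \<epsilon>"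
  obtains g where "g \<in> unit_ball M" "(\<lambda>N. \<integral>x. \<bar>F N x - g x\<bar> \<partial>M) \<longlonglongrightarrow> 0"
proof -
  have Fm [measurable]: "F N \<in> borel_measurable M" and F1: "\<bar>F N x\<bar> \<le> 1" for N x
    using unit_ballD[OF F] by auto
  have int: "integrable M (\<lambda>x. \<bar>F N x - h x\<bar>)" if "h \<in> unit_ball M" for N h
  proof (rule integrable_bounded[where B=2])
    show "\<bar>\<bar>F N x - h x\<bar>\<bar> \<le> 2" for x
      using F1[of N x] unit_ballD(2)[OF that, of x] by simp
  qed (use unit_ballD(1)[OF that] in measurable)
  obtain n0 where n0: "\<And>k N N'. n0 k \<le> N \<Longrightarrow> n0 k \<le> N' \<Longrightarrow> (\<integral>x. \<bar>F N x - F N' x\<bar> \<partial>M) \<le> (1/2) ^ k"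
    using Cauchy[of "(1/2) ^ k" for k] by (metis half_gt_zero_iff zero_less_one zero_less_power)
  \<comment> \<open>The maximum makes \<open>r\<close> nondecreasing, so \<open>r (Suc k)\<close> is
    also at least \<open>n0 k\<close> and consecutive terms can be compared.\<close>
  define r where "r k = Max (n0 ` {..k})" for k :: nat
  have r: "n0 k \<le> r k" for k by (auto simp: r_def)
  have r_mono: "n0 k \<le> r (Suc k)" for k unfolding r_def by (rule Max_ge) auto
  define d where "d k x = F (r (Suc k)) x - F (r k) x" for k x
  have d_int: "integrable M (\<lambda>x. \<bar>d k x\<bar>)" for k unfolding d_def by (rule int[OF F])
  have d_le: "(\<integral>x. \<bar>d k x\<bar> \<partial>M) \<le> (1/2) ^ k" for k
    unfolding d_def by (rule n0[OF r_mono r])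
  have dm [measurable]: "d k \<in> borel_measurable M" for k unfolding d_def[abs_def] by measurable
  have "(\<integral>\<^sup>+x. (\<Sum>k. ennreal \<bar>d k x\<bar>) \<partial>M) = (\<Sum>k. \<integral>\<^sup>+x. ennreal \<bar>d k x\<bar> \<partial>M)"
    by (rule nn_integral_suminf) measurable
  also have "\<dots> = (\<Sum>k. ennreal (\<integral>x. \<bar>d k x\<bar> \<partial>M))"
    by (simp add: nn_integral_eq_integral[OF d_int])
  also have "\<dots> \<le> (\<Sum>k. ennreal ((1/2) ^ k))"
    by (intro suminf_le ennreal_leI d_le) auto
  also have "\<dots> = ennreal (\<Sum>k. (1/2) ^ k)"
    by (rule suminf_ennreal2) (auto intro: summable_geometric)
  finally have "(\<integral>\<^sup>+x. (\<Sum>k. ennreal \<bar>d k x\<bar>) \<partial>M) \<noteq> \<infinity>" by (auto simp: top_unique)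
  then have "AE x in M. (\<Sum>k. ennreal \<bar>d k x\<bar>) \<noteq> \<infinity>"
    by (intro nn_integral_PInf_AE) measurable
  then have conv: "AE x in M. convergent (\<lambda>k. F (r k) x)"
  proof eventually_elim
    case (elim x)
    then have "summable (\<lambda>k. \<bar>d k x\<bar>)" by (intro summable_suminf_not_top) auto
    then have "summable (\<lambda>k. d k x)" by (rule summable_rabs_cancel)
    then have "convergent (\<lambda>n. F (r 0) x + (\<Sum>k<n. d k x))"
      by (intro convergent_add convergent_const) (simp add: summable_iff_convergent)
    then show ?case unfolding d_def by (simp add: sum_lessThan_telescope[of "\<lambda>k. F (r k) x"])
  qed
  \<comment> \<open>Clamping does not change the limit where it exists, and it keeps
    \<open>g\<close> bounded by 1 on the exceptional null set too.\<close>
  define g where "g x = max (-1) (min 1 (lim (\<lambda>k. F (r k) x)))" for x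
  have gm [measurable]: "g \<in> borel_measurable M" unfolding g_def[abs_def] by measurable
  have g: "g \<in> unit_ball M" by (auto simp: unit_ball_def g_def abs_le_iff)
  have lim_g: "AE x in M. (\<lambda>k. \<bar>F (r k) x - g x\<bar>) \<longlonglongrightarrow> 0"
    using conv
  proof eventually_elim
    case (elim x)
    then have L: "(\<lambda>k. F (r k) x) \<longlonglongrightarrow> lim (\<lambda>k. F (r k) x)" by (simp add: convergent_LIMSEQ_iff)
    have "lim (\<lambda>k. F (r k) x) \<le> 1"
      by (rule LIMSEQ_le_const2[OF L]) (use F1 in \<open>auto simp: abs_le_iff\<close>)
    moreover have "-1 \<le> lim (\<lambda>k. F (r k) x)"
      by (rule LIMSEQ_le_const[OF L]) (use F1 in \<open>force simp: abs_le_iff\<close>)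
    ultimately have "(\<lambda>k. F (r k) x) \<longlonglongrightarrow> g x" using L by (simp add: g_def)
    then show ?case by (intro tendsto_rabs_zero) (rule LIM_zero)
  qed
  have "(\<lambda>k. \<integral>x. \<bar>F (r k) x - g x\<bar> \<partial>M) \<longlonglongrightarrow> (\<integral>x. 0 \<partial>M)"
  proof (rule integral_dominated_convergence[where w="\<lambda>_. 2"])
    show "AE x in M. norm \<bar>F (r k) x - g x\<bar> \<le> 2" for k
    proof (rule AE_I2)
      show "norm \<bar>F (r k) x - g x\<bar> \<le> 2" for x
        using F1[of "r k" x] unit_ballD(2)[OF g, of x] by simp
    qed
  qed (use lim_g in auto)
  then have sub: "(\<lambda>k. \<integral>x. \<bar>F (r k) x - g x\<bar> \<partial>M) \<longlonglongrightarrow> 0" by simp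
  have "(\<lambda>N. \<integral>x. \<bar>F N x - g x\<bar> \<partial>M) \<longlonglongrightarrow> 0"
  proof (rule LIMSEQ_I)
    fix e :: real assume e: "0 < e"
    have "\<forall>\<^sub>F k in sequentially. (\<integral>x. \<bar>F (r k) x - g x\<bar> \<partial>M) < e / 2"
      using sub e by (intro order_tendstoD) auto
    moreover have "\<forall>\<^sub>F k in sequentially. (1/2) ^ k < e / 2"
      by (rule order_tendstoD(2)[OF LIMSEQ_realpow_zero]) (use e in auto)
    ultimately obtain k where k: "(\<integral>x. \<bar>F (r k) x - g x\<bar> \<partial>M) < e / 2" "(1/2) ^ k < e / 2"
      by (metis (mono_tags, lifting) eventually_conj eventually_happens trivial_limit_sequentially)
    have "(\<integral>x. \<bar>F N x - g x\<bar> \<partial>M) < e" if "r k \<le> N" for N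
    proof -
      have "(\<integral>x. \<bar>F N x - g x\<bar> \<partial>M) \<le> (\<integral>x. \<bar>F N x - F (r k) x\<bar> + \<bar>F (r k) x - g x\<bar> \<partial>M)"
        by (intro integral_mono Bochner_Integration.integrable_add int g F) auto
      also have "\<dots> = (\<integral>x. \<bar>F N x - F (r k) x\<bar> \<partial>M) + (\<integral>x. \<bar>F (r k) x - g x\<bar> \<partial>M)"
        by (intro Bochner_Integration.integral_add int g F)
      also have "(\<integral>x. \<bar>F N x - F (r k) x\<bar> \<partial>M) \<le> (1/2) ^ k"
        using r[of k] that by (intro n0) auto
      finally show ?thesis using k by linarith
    qed
    then show "\<exists>no. \<forall>N\<ge>no. norm ((\<integral>x. \<bar>F N x - g x\<bar> \<partial>M) - 0) < e"
      by (intro exI[of _ "r k"]) auto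
  qed
  with g show thesis by (rule that)
qed

section \<open>Cauchy property of the averages\<close>

context commuting_system
begin

lemma distr_T_pow: "distr M M (T i ^^ n) = M"
proof (induction n)
  case (Suc n)
  have "distr M M (T i ^^ Suc n) = distr (distr M M (T i ^^ n)) M (T i)"
    by (simp add: distr_distr comp_def)
  then show ?case by (simp add: Suc distr_T comp_def)
qed (simp add: distr_id id_def)

text \<open>If this failed, each \<open>n\<close> would admit times \<open>a n\<close> and
  \<open>b n\<close>, both at least \<open>n\<close>, whose averages are more than \<epsilon> apart.
  Metastability for \<open>F n = max (a n) (b n)\<close>, over a parameter concentrated at one
  point, yields a stable window containing such a pair.\<close>

lemma multi_avg_L1_Cauchy:
  assumes f: "\<And>i. f i \<in> unit_ball M" and \<epsilon>: "0 < \<epsilon>"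
  shows "\<exists>n. \<forall>N\<ge>n. \<forall>N'\<ge>n. (\<integral>x. \<bar>multi_avg T j f N x - multi_avg T j f N' x\<bar> \<partial>M) \<le> \<epsilon>"
proof (rule ccontr)
  define D where "D N N' = (\<integral>x. \<bar>multi_avg T j f N x - multi_avg T j f N' x\<bar> \<partial>M)" for N N'
  assume "\<not> ?thesis"
  then have "\<forall>n. \<exists>N N'. n \<le> N \<and> n \<le> N' \<and> \<not> D N N' \<le> \<epsilon>" unfolding D_def by blast
  then obtain a b where ab: "\<And>n. n \<le> a n" "\<And>n. n \<le> b n" "\<And>n. \<not> D (a n) (b n) \<le> \<epsilon>" by metis
  define f' where "f' i y = f i (fst y)" for i and y :: "'a \<times> nat"
  have "admissible (return_pmf 0) f'"
    using f by (simp add: admissible_def unit_ball_fibre f'_def)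
  then obtain n where n: "stable_on (return_pmf 0) j f' \<epsilon> n (max (a n) (b n))"
    using metastable[of j] \<epsilon> unfolding metastable_def
    by (elim allE[of _ \<epsilon>] impE allE[of _ "\<lambda>n. max (a n) (b n)"]) blast+
  have avg: "lavg j f' N y = multi_avg T j f N (fst y)" for N y
    by (simp add: multi_avg_def f'_def lift_map_pow)
  have A: "multi_avg T j f N \<in> unit_ball M" for N by (rule multi_avg_unit_ball[OF f])
  have [measurable]: "multi_avg T j f N \<in> borel_measurable M" for N using A by (rule unit_ballD)
  have "(\<integral>y. \<bar>lavg j f' N y - lavg j f' N' y\<bar> \<partial>fibre (return_pmf 0)) = D N N'" for N N'
  proof (subst integral_fibre[where B=2])
    show "\<bar>\<bar>lavg j f' N y - lavg j f' N' y\<bar>\<bar> \<le> 2" for y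
      using unit_ballD(2)[OF A, of N "fst y"] unit_ballD(2)[OF A, of N' "fst y"] by (simp add: avg)
  qed (simp_all add: avg D_def)
  with n have "\<forall>N\<in>{n..max (a n) (b n)}. \<forall>N'\<in>{n..max (a n) (b n)}. D N N' \<le> \<epsilon>"
    by (simp only: stable_on_def)
  then have "D (a n) (b n) \<le> \<epsilon>" using ab(1,2)[of n] by simp
  with ab(3) show False by blast
qed

end

section \<open>Passage to essentially bounded functions and to convergence in L^2\<close>

lemma distr_measure_preserving:
  assumes "measure_preserving M T" shows "distr M M T = M"
proof (rule measure_eqI)
  show "emeasure (distr M M T) A = emeasure M A" if "A \<in> sets (distr M M T)" for A
    using assms that by (simp add: measure_preserving_def emeasure_distr)
qed simp

lemma Linfty_bound:
  assumes "f \<in> Linfty M"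
  obtains B where "0 < B" "AE x in M. \<bar>f x\<bar> \<le> B"
proof -
  obtain n :: nat where n: "esssup M (\<lambda>x. ereal \<bar>f x\<bar>) < ereal (real n)"
    using assms less_PInf_Ex_of_nat by (auto simp: Linfty_def)
  have "AE x in M. \<bar>f x\<bar> \<le> real n + 1"
    using esssup_AE[of "\<lambda>x. ereal \<bar>f x\<bar>" M]
  proof eventually_elim
    case (elim x)
    then have "ereal \<bar>f x\<bar> < ereal (real n)" using n by (rule le_less_trans)
    then show ?case by simp
  qed
  then show thesis by (intro that[of "real n + 1"]) auto
qed

text \<open>Pointwise \<open>(f x)\<^sup>2 \<le> B * \<bar>f x\<bar>\<close>; thus L^1 convergence
  of uniformly bounded functions gives L^2 convergence.\<close>

lemma (in prob_space) L2_norm_le_L1: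
  assumes "f \<in> borel_measurable M" "\<And>x. \<bar>f x\<bar> \<le> B"
  shows "L2_norm M f \<le> sqrt (B * (\<integral>x. \<bar>f x\<bar> \<partial>M))"
proof -
  have [measurable]: "f \<in> borel_measurable M" by fact
  have i: "integrable M (\<lambda>x. \<bar>f x\<bar>)"
    by (rule integrable_bounded[where B=B]) (use assms in auto)
  have le: "(f x)\<^sup>2 \<le> B * \<bar>f x\<bar>" for x
    using mult_right_mono[OF assms(2)[of x], of "\<bar>f x\<bar>"] by (simp add: power2_eq_square abs_mult_self_eq)
  have "(\<integral>x. (f x)\<^sup>2 \<partial>M) \<le> (\<integral>x. B * \<bar>f x\<bar> \<partial>M)"
    by (rule integral_mono') (use i le in \<open>auto intro: order_trans[OF zero_le_power2 le]\<close>)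
  then show ?thesis using i by (simp add: L2_norm_def)
qed

theorem theorem1p1:
  fixes M :: "'a measure" and l :: nat and T :: "nat \<Rightarrow> 'a \<Rightarrow> 'a"
  assumes "prob_space M"
    and "l \<ge> 1"
    and "\<And>i. i \<in> {1..l} \<Longrightarrow> invertible_measure_preserving M (T i)"
    and "\<And>i. i \<in> {1..l} \<Longrightarrow> ergodic M (T i)"
    and "\<And>i j x. i \<in> {1..l} \<Longrightarrow> j \<in> {1..l} \<Longrightarrow> x \<in> space M \<Longrightarrow> T i (T j x) = T j (T i x)"
    and "\<And>i j. i \<in> {1..l} \<Longrightarrow> j \<in> {1..l} \<Longrightarrow> i \<noteq> j \<Longrightarrow>
           ergodic M (T i \<circ> inv_into (space M) (T j))"
  shows "\<forall>f :: nat \<Rightarrow> 'a \<Rightarrow> real. (\<forall>i\<in>{1..l}. f i \<in> Linfty M) \<longrightarrow>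
           converges_in_L2 M
             (\<lambda>N x. 1 / real N * (\<Sum>n<N. \<Prod>i=1..l. f i ((T i ^^ n) x)))"
proof (intro allI impI)
  fix f :: "nat \<Rightarrow> 'a \<Rightarrow> real"
  assume fL: "\<forall>i\<in>{1..l}. f i \<in> Linfty M"
  interpret prob_space M by fact
  \<comment> \<open>Outside \<open>space M\<close> nothing is known about \<open>T i\<close>; there it is replaced by the identity.\<close>
  define S where "S i x = (if i \<in> {1..l} \<and> x \<in> space M then T i x else x)" for i x
  define R where "R i x = (if i \<in> {1..l} \<and> x \<in> space M then inv_into (space M) (T i) x else x)" for i x
  have mp: "measure_preserving M (T i)" and bij: "bij_betw (T i) (space M) (space M)"
    and inv: "inv_into (space M) (T i) \<in> M \<rightarrow>\<^sub>M M" if "i \<in> {1..l}" for i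
    using assms(3)[OF that] by (auto simp: invertible_measure_preserving_def)
  have Tm: "T i \<in> M \<rightarrow>\<^sub>M M" if "i \<in> {1..l}" for i
    using mp[OF that] by (simp add: measure_preserving_def)
  have T_space: "T i x \<in> space M" if "i \<in> {1..l}" "x \<in> space M" for i x
    using Tm that by (auto dest: measurable_space)
  have inv_space: "inv_into (space M) (T i) x \<in> space M" if "i \<in> {1..l}" "x \<in> space M" for i x
    using inv that by (auto dest: measurable_space)
  have Sm: "S i \<in> M \<rightarrow>\<^sub>M M" for i
    by (cases "i \<in> {1..l}") (auto simp: S_def[abs_def] Tm cong: measurable_cong)
  interpret commuting_system M S R
  proof
    show "S i \<in> M \<rightarrow>\<^sub>M M" for i by (rule Sm)
    show "R i \<in> M \<rightarrow>\<^sub>M M" for i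
      by (cases "i \<in> {1..l}") (auto simp: R_def[abs_def] inv cong: measurable_cong)
    show "distr M M (S i) = M" for i
    proof (cases "i \<in> {1..l}")
      case True
      then have "distr M M (S i) = distr M M (T i)" by (intro distr_cong) (auto simp: S_def)
      then show ?thesis using distr_measure_preserving[OF mp[OF True]] by simp
    next
      case False
      then have "S i = (\<lambda>x. x)" by (auto simp: S_def fun_eq_iff)
      then show ?thesis by simp
    qed
    show "R i (S i x) = x" for i x
      using bij[of i] T_space[of i x] by (auto simp: R_def S_def bij_betw_def inv_into_f_f)
    show "S i (R i x) = x" for i x
      using bij[of i] inv_space[of i x] by (auto simp: R_def S_def bij_betw_def f_inv_into_f)
    show "S i (S k x) = S k (S i x)" for i k x
      using assms(5)[of i k x] T_space by (auto simp: S_def)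
  qed
  have S_pow: "(S i ^^ n) x = (T i ^^ n) x \<and> (T i ^^ n) x \<in> space M" if "i \<in> {1..l}" "x \<in> space M" for i n x
    using that by (induction n) (auto simp: S_def T_space)
  have "\<exists>B>0. AE x in M. \<bar>f i x\<bar> \<le> B" if "i \<in> {1..l}" for i
    using fL that Linfty_bound by metis
  then obtain B where B: "\<And>i. i \<in> {1..l} \<Longrightarrow> 0 < B i" "\<And>i. i \<in> {1..l} \<Longrightarrow> AE x in M. \<bar>f i x\<bar> \<le> B i"
    by metis
  have fm: "f i \<in> borel_measurable M" if "i \<in> {1..l}" for i using fL that by (simp add: Linfty_def)
  \<comment> \<open>Scaling and clamping give functions bounded by 1 everywhere that agree almost
    everywhere with \<open>f i / B i\<close>. The value 0 covers the remaining indices, since the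
    lemmas on averages ask for a bound at all of them.\<close>
  define u where "u i x = (if i \<in> {1..l} then max (-1) (min 1 (f i x / B i)) else 0)" for i x
  have u: "u i \<in> unit_ball M" for i
    using fm by (cases "i \<in> {1..l}") (auto simp: unit_ball_def u_def[abs_def] abs_le_iff)
  have fu: "AE x in M. f i x = B i * u i x" if "i \<in> {1..l}" for i
    using B(2)[OF that]
  proof eventually_elim
    case (elim x)
    then have "\<bar>f i x / B i\<bar> \<le> 1" using B(1)[OF that] by simp
    then have "- 1 \<le> f i x / B i" "f i x / B i \<le> 1" by linarith+
    then have "u i x = f i x / B i" using that by (simp add: u_def)
    then show ?case using B(1)[OF that] by simp
  qed
  define A where "A = multi_avg S l u"
  have A: "A N \<in> unit_ball M" for N unfolding A_def by (rule multi_avg_unit_ball[OF u])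
  have [measurable]: "A N \<in> borel_measurable M" for N using A by (rule unit_ballD)
  define c where "c = (\<Prod>i=1..l. B i)"
  define F where "F N x = 1 / real N * (\<Sum>n<N. \<Prod>i=1..l. f i ((T i ^^ n) x))" for N x
  \<comment> \<open>Only countably many iterates occur, and each preserves the measure, so the
    preimages of the exceptional null sets are null. One null set then serves all averages.\<close>
  have "AE x in M. \<forall>n. \<forall>i\<in>{1..l}. f i ((S i ^^ n) x) = B i * u i ((S i ^^ n) x)"
  proof (subst AE_all_countable, rule allI, rule AE_finite_allI)
    fix n i assume i: "i \<in> {1..l}"
    show "AE x in M. f i ((S i ^^ n) x) = B i * u i ((S i ^^ n) x)"
      by (rule AE_distrD[OF T_pow_measurable]) (unfold distr_T_pow, rule fu[OF i])
  qed simp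
  then have FA: "AE x in M. \<forall>N. F N x = c * A N x"
    using AE_space
  proof eventually_elim
    case (elim x)
    have "(\<Prod>i=1..l. f i ((T i ^^ n) x)) = c * (\<Prod>i=1..l. u i ((S i ^^ n) x))" for n
      unfolding c_def prod.distrib[symmetric] using elim S_pow by (intro prod.cong) auto
    then show ?case by (simp add: F_def A_def multi_avg_def sum_distrib_left sum_divide_distrib)
  qed
  have Fm [measurable]: "F N \<in> borel_measurable M" for N
  proof -
    have "(\<lambda>x. f i ((T i ^^ n) x)) \<in> borel_measurable M" if i: "i \<in> {1..l}" for i n
    proof (rule measurable_compose[OF _ fm[OF i]])
      show "T i ^^ n \<in> M \<rightarrow>\<^sub>M M"
        by (induction n) (auto intro: measurable_compose[OF _ Tm[OF i]])
    qed
    then show ?thesis unfolding F_def[abs_def]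
      by (intro borel_measurable_times borel_measurable_sum borel_measurable_prod) auto
  qed
  have L2I: "h \<in> L2 M" if [measurable]: "h \<in> borel_measurable M"
    and v: "v \<in> unit_ball M" and h: "AE x in M. h x = c * v x" for h v
  proof -
    have "AE x in M. norm ((h x)\<^sup>2) \<le> c\<^sup>2"
      using h
    proof eventually_elim
      case (elim x)
      have "(v x)\<^sup>2 \<le> 1" using unit_ballD(2)[OF v, of x] by (simp add: abs_square_le_1)
      from mult_left_mono[OF this, of "c\<^sup>2"] show ?case by (simp add: elim power_mult_distrib)
    qed
    then have "integrable M (\<lambda>x. (h x)\<^sup>2)" by (rule integrable_const_bound) measurable
    then show ?thesis by (simp add: L2_def)
  qed
  obtain g where g: "g \<in> unit_ball M" and lim: "(\<lambda>N. \<integral>x. \<bar>A N x - g x\<bar> \<partial>M) \<longlonglongrightarrow> 0"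
    using L1_Cauchy_limit[where F=A, OF A multi_avg_L1_Cauchy[where f=u and j=l, OF u, folded A_def]] by blast
  have [measurable]: "g \<in> borel_measurable M" using g by (rule unit_ballD)
  have "L2_norm M (\<lambda>x. F N x - c * g x) \<le> \<bar>c\<bar> * sqrt (2 * (\<integral>x. \<bar>A N x - g x\<bar> \<partial>M))" for N
  proof -
    have "(\<integral>x. (F N x - c * g x)\<^sup>2 \<partial>M) = (\<integral>x. c\<^sup>2 * (A N x - g x)\<^sup>2 \<partial>M)"
    proof (rule integral_cong_AE)
      show "AE x in M. (F N x - c * g x)\<^sup>2 = c\<^sup>2 * (A N x - g x)\<^sup>2"
        using FA by eventually_elim (simp add: power_mult_distrib[symmetric] right_diff_distrib)
    qed measurable
    then have "L2_norm M (\<lambda>x. F N x - c * g x) = \<bar>c\<bar> * L2_norm M (\<lambda>x. A N x - g x)"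
      by (simp add: L2_norm_def real_sqrt_mult)
    moreover have "\<bar>A N x - g x\<bar> \<le> 2" for x
      using unit_ballD(2)[OF A, of N x] unit_ballD(2)[OF g, of x] by simp
    then have "L2_norm M (\<lambda>x. A N x - g x) \<le> sqrt (2 * (\<integral>x. \<bar>A N x - g x\<bar> \<partial>M))"
      by (intro L2_norm_le_L1) auto
    ultimately show ?thesis by (simp add: mult_left_mono)
  qed
  then have bound: "norm (L2_norm M (\<lambda>x. F N x - c * g x)) \<le> \<bar>c\<bar> * sqrt (2 * (\<integral>x. \<bar>A N x - g x\<bar> \<partial>M))" for N
    by (simp add: L2_norm_def)
  have "(\<lambda>N. \<bar>c\<bar> * sqrt (2 * (\<integral>x. \<bar>A N x - g x\<bar> \<partial>M))) \<longlonglongrightarrow> \<bar>c\<bar> * sqrt (2 * 0)"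
    by (intro tendsto_intros lim)
  then have "(\<lambda>N. \<bar>c\<bar> * sqrt (2 * (\<integral>x. \<bar>A N x - g x\<bar> \<partial>M))) \<longlonglongrightarrow> 0" by simp
  from Lim_null_comparison[OF always_eventually[OF allI[OF bound]] this]
  have "(\<lambda>N. L2_norm M (\<lambda>x. F N x - c * g x)) \<longlonglongrightarrow> 0" .
  moreover have "F N \<in> L2 M" for N using FA by (intro L2I[OF Fm A]) auto
  moreover have "(\<lambda>x. c * g x) \<in> L2 M" by (intro L2I[OF _ g]) auto
  ultimately have "converges_in_L2 M F"
    unfolding converges_in_L2_def by (auto intro!: bexI[of _ "\<lambda>x. c * g x"])
  then show "converges_in_L2 M (\<lambda>N x. 1 / real N * (\<Sum>n<N. \<Prod>i=1..l. f i ((T i ^^ n) x)))"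
    unfolding F_def[abs_def] .
qed

end
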